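(* Suppose Assumptions A1–A3 hold and the parameters $\rho,\gamma,\beta>0$ satisfy $\rho\gamma<1$, $\rho\ge\beta$, $$\frac{(1-\rho\gamma)\gamma}{2}+\gamma-\frac{1-\rho\gamma}{\rho}>0,\qquad \beta>(3+3L_\mu)L_\mu+2,$$ with $\gamma=\mathcal{O}(1/R)$ chosen such that $\alpha_0:=\rho\gamma<1$ remains constant. Let $a$ be sampled uniformly from $\{1,\ldots,R\}$, independently of the iterates. Given the fixed iteration number $R$, if the smoothing parameter satisfies $\mu\le 1/\sqrt R$ and the number of oracle calls at each iteration is $J=R$, then, for constants $V,\tilde c$ not depending on the problem accuracy, $$\mathbb{E}\big[\Psi^a+\|Ax^{a+1}-b\|^2\big]\le \frac{4V}{R}\,\mathbb{E}[Q^0-Q^R]+\frac{2\,\mathbb{E}[Q^0]}{R(1-\alpha_0)}+\tilde c\,\frac{\tilde\sigma^2}{R}+\frac{L^2N^2}{R}.$$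
   Context: Problem: minimize $f(x)+h(x)$ over $x\in X$ subject to $Ax=b$, where $A\in\mathbb{R}^{M\times N}$, $b\in\mathbb{R}^M$, $X\subseteq\mathbb{R}^N$ is closed and convex, $f:\mathbb{R}^N\to\mathbb{R}$ is differentiable (possibly nonconvex) with $L$-Lipschitz gradient, and $h:\mathbb{R}^N\to\mathbb{R}$ is convex, lower semicontinuous, possibly nonsmooth. It is assumed that $f(x)\ge0$ and $h(x)\ge0$ for $x\in X$. $\|\cdot\|$ is the Euclidean norm and $\|v\|_W^2:=v^TWv$. Oracle: for a random $\xi$, a noisy value $\mathcal F(x,\xi)$ of $f(x)$ is available, with: (A1) $\mathbb{E}_\xi[\mathcal F(x,\xi)]=f(x)$, $\mathbb{E}_\xi[\nabla\mathcal F(x,\xi)]=\nabla f(x)$; (A2) $\mathbb{E}[\|\nabla\mathcal F(x,\xi)-\nabla f(x)\|^2]\le\sigma^2$ for a constant $\sigma\ge0$; (A3) $\|\nabla f(x)\|\le K$ for a constant $K\ge0$ (for all $x$). Smoothing: for $\mu>0$, $f_\mu(x):=\mathbb{E}_v[f(x+\mu v)]$ with $v$ uniform on the unit ball of $\mathbb{R}^N$; $\nabla f_\mu$ is $L_\mu$-Lipschitz with $L_\mu\le L$. The gradient estimator is $G_\mu(x,v,\xi):=\frac N\mu(\mathcal F(x+\mu v,\xi)-\mathcal F(x,\xi))v$ with $v$ uniform on the unit sphere. Put $\tilde\sigma^2:=2N[K^2+\sigma^2+\mu^2L^2N]$. Algorithm (PZO-PDA): $x^0,\lambda^0$ are given and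 $B\in\mathbb{R}^{M\times N}$ satisfies $A^TA+B^TB\succeq I_N$. For $r=0,1,2,\ldots$, draw $v_1^r,\dots,v_J^r$ i.i.d. uniform on the unit sphere and independent noise $\xi_1^r,\dots,\xi_J^r$ (independent of the past), set $\overline G_\mu^r=\frac1J\sum_{j=1}^JG_\mu(x^r,v_j^r,\xi_j^r)$ and $$x^{r+1}=\arg\min_{x\in X}\ \langle\overline G_\mu^r,x-x^r\rangle+h(x)+\langle(1-\rho\gamma)\lambda^r,Ax-b\rangle+\tfrac\rho2\|Ax-b\|^2+\tfrac\beta2\|x-x^r\|^2_{B^TB},$$ $$\lambda^{r+1}=(1-\rho\gamma)\lambda^r+\rho(Ax^{r+1}-b).$$ The following estimates, quoted by the paper from the literature as consequences of A1–A3, are taken as given (conditionally on the past): $\mathbb{E}[\overline G_\mu^r]=\nabla f_\mu(x^r)$ and $\mathbb{E}\|\overline G_\mu^r-\nabla f_\mu(x^r)\|^2\le\tilde\sigma^2/J$. Also $\|\nabla f_\mu(x)-\nabla f(x)\|\le\mu NL/2$. Potential: $C(x,\lambda):=f_\mu(x)+h(x)+\langle(1-\rho\gamma)\lambda,Ax-b-\gamma\lambda\rangle+\frac\rho2\|Ax-b\|^2$ and $$Q^r:=C(x^{r+1},\lambda^{r+1})+\tfrac{(1-\rho\gamma)\gamma}2\|\lambda^{r+1}\|^2+\tfrac12\Big(\tfrac{1-\rho\gamma}\rho\|\lambda^{r+1}-\lambda^r\|^2+\beta\|x^{r+1}-x^r\|^2_{B^TB}+3L_\mu^2\|x^{r+1}-x^r\|^2\Big).$$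 Optimality gap: with $\mathrm{prox}_g^\beta(x):=\arg\min_z\frac\beta2\|x-z\|^2+g(z)$ and $\iota_X$ the indicator function of $X$ ($0$ on $X$, $+\infty$ off $X$), $$\Psi^r:=\Big\|x^r-\mathrm{prox}^\beta_{h+\iota_X}\big[x^r-\tfrac1\beta(\nabla f(x^r)+A^T\lambda^r)\big]\Big\|^2+\tfrac1{\beta^2}\|x^{r+1}-x^r\|^2+\tfrac1{\rho^2}\|\lambda^{r+1}-\lambda^r\|^2.$$ "Constants not depending on the problem accuracy" means that $V,\tilde c$ depend only on $A,B$ and the parameters $\beta,\rho,\gamma,L_\mu$, and not otherwise on $R$, $J$, $\mu$, or on the iterates. Expectations are over all the randomness of the algorithm and of $a$.
   Formalization: γ=O(1/R) is read as γ ≤ κ/R with κ(1−α₀)<1, since the bound fails when γR(1−α₀)>1; and L_μ=0 is allowed only if L=0, since otherwise f_μ may be negative on X and the bound fails. *)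

theory Defs
  imports "HOL-Probability.Probability"
begin

section \<open>Problem data\<close>

definition lower_semicontinuous :: "('a::topological_space \<Rightarrow> real) \<Rightarrow> bool" where
  "lower_semicontinuous h \<longleftrightarrow> (\<forall>x. \<forall>y < h x. eventually (\<lambda>z. y < h z) (nhds x))"

definition psd :: "real^'n^'n \<Rightarrow> bool" where
  "psd W \<longleftrightarrow> transpose W = W \<and> (\<forall>v. 0 \<le> v \<bullet> (W *v v))"

definition wnorm_sq :: "real^'n^'n \<Rightarrow> real^'n \<Rightarrow> real" where
  "wnorm_sq W v = v \<bullet> (W *v v)"

definition composite_problem ::
  "(real^'n) set \<Rightarrow> (real^'n \<Rightarrow> real) \<Rightarrow> (real^'n \<Rightarrow> real^'n) \<Rightarrow> real \<Rightarrow> (real^'n \<Rightarrow> real) \<Rightarrow> bool"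
where
  "composite_problem X f gradf L h \<longleftrightarrow>
     closed X \<and> convex X \<and>
     (\<forall>x. GDERIV f x :> gradf x) \<and> L-lipschitz_on UNIV gradf \<and>
     convex_on UNIV h \<and> lower_semicontinuous h \<and>
     (\<forall>x\<in>X. 0 \<le> f x \<and> 0 \<le> h x)"


section \<open>Zeroth-order oracle and smoothing\<close>

text \<open>The noise has distribution \<open>D\<close>. Joint measurability of \<open>F\<close> is part of its being a random
  function; it also follows from the two subsequent clauses (continuity in \<open>x\<close>, measurability
  in \<open>\<xi>\<close>).\<close>

definition stochastic_oracle ::
  "'e measure \<Rightarrow> (real^'n \<Rightarrow> 'e \<Rightarrow> real) \<Rightarrow> (real^'n \<Rightarrow> 'e \<Rightarrow> real^'n)
   \<Rightarrow> (real^'n \<Rightarrow> real) \<Rightarrow> (real^'n \<Rightarrow> real^'n) \<Rightarrow> real \<Rightarrow> real \<Rightarrow> bool"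
where
  "stochastic_oracle D F gradF f gradf \<sigma> K \<longleftrightarrow>
     prob_space D \<and>
     (\<lambda>(x, \<xi>). F x \<xi>) \<in> borel_measurable (borel \<Otimes>\<^sub>M D) \<and>
     (\<forall>x. \<forall>\<xi>\<in>space D. GDERIV (\<lambda>y. F y \<xi>) x :> gradF x \<xi>) \<and>
     (\<forall>x. has_bochner_integral D (\<lambda>\<xi>. F x \<xi>) (f x)) \<and>
     (\<forall>x. has_bochner_integral D (\<lambda>\<xi>. gradF x \<xi>) (gradf x)) \<and>
     0 \<le> \<sigma> \<and>
     (\<forall>x. (\<integral>\<^sup>+\<xi>. ennreal ((norm (gradF x \<xi> - gradf x))\<^sup>2) \<partial>D) \<le> ennreal (\<sigma>\<^sup>2)) \<and>
     0 \<le> K \<and>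
     (\<forall>x. norm (gradf x) \<le> K)"

definition unif_ball :: "(real^'n) measure" where
  "unif_ball = uniform_measure lborel (cball 0 1)"

text \<open>The normalised surface measure of the unit sphere, as the law of the direction
  \<open>v / norm v\<close> of a uniform point of the ball (\<open>sgn\<close> is that direction; \<open>v = 0\<close> is a null event).\<close>

definition unif_sphere :: "(real^'n) measure" where
  "unif_sphere = distr unif_ball borel sgn"

definition smoothing :: "real \<Rightarrow> (real^'n \<Rightarrow> real) \<Rightarrow> real^'n \<Rightarrow> real" where
  "smoothing \<mu> f x = (\<integral>v. f (x + \<mu> *\<^sub>R v) \<partial>unif_ball)"

definition zo_gradient ::
  "real \<Rightarrow> (real^'n \<Rightarrow> 'e \<Rightarrow> real) \<Rightarrow> real^'n \<Rightarrow> real^'n \<Rightarrow> 'e \<Rightarrow> real^'n"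
where
  "zo_gradient \<mu> F x v \<xi> = (real CARD('n) / \<mu> * (F (x + \<mu> *\<^sub>R v) \<xi> - F x \<xi>)) *\<^sub>R v"

definition zo_gradient_avg ::
  "real \<Rightarrow> (real^'n \<Rightarrow> 'e \<Rightarrow> real) \<Rightarrow> nat \<Rightarrow> real^'n \<Rightarrow> (nat \<Rightarrow> real^'n) \<Rightarrow> (nat \<Rightarrow> 'e) \<Rightarrow> real^'n"
where
  "zo_gradient_avg \<mu> F J x v \<xi> = (1 / real J) *\<^sub>R (\<Sum>j=1..J. zo_gradient \<mu> F x (v j) (\<xi> j))"

definition sigma_tilde_sq :: "nat \<Rightarrow> real \<Rightarrow> real \<Rightarrow> real \<Rightarrow> real \<Rightarrow> real" where
  "sigma_tilde_sq N K \<sigma> \<mu> L = 2 * real N * (K\<^sup>2 + \<sigma>\<^sup>2 + \<mu>\<^sup>2 * L\<^sup>2 * real N)"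


section \<open>The algorithm\<close>

definition pda_objective ::
  "real^'n^'m \<Rightarrow> real^'n^'m \<Rightarrow> real^'m \<Rightarrow> (real^'n \<Rightarrow> real) \<Rightarrow> real \<Rightarrow> real \<Rightarrow> real
   \<Rightarrow> real^'n \<Rightarrow> real^'n \<Rightarrow> real^'m \<Rightarrow> real^'n \<Rightarrow> real"
where
  "pda_objective A B b h \<rho> \<gamma> \<beta> g xr lr x =
     g \<bullet> (x - xr) + h x + ((1 - \<rho> * \<gamma>) *\<^sub>R lr) \<bullet> (A *v x - b)
     + \<rho> / 2 * (norm (A *v x - b))\<^sup>2 + \<beta> / 2 * wnorm_sq (transpose B ** B) (x - xr)"

definition sampling ::
  "'w measure \<Rightarrow> 'e measure \<Rightarrow> nat \<Rightarrow> (nat \<Rightarrow> nat \<Rightarrow> 'w \<Rightarrow> real^'n) \<Rightarrow> (nat \<Rightarrow> nat \<Rightarrow> 'w \<Rightarrow> 'e) \<Rightarrow> bool"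
where
  "sampling \<Omega> D J v \<xi> \<longleftrightarrow>
     prob_space \<Omega> \<and>
     prob_space.indep_vars \<Omega> (\<lambda>_. borel \<Otimes>\<^sub>M D) (\<lambda>(r, j) \<omega>. (v r j \<omega>, \<xi> r j \<omega>)) (UNIV \<times> {1..J}) \<and>
     (\<forall>r. \<forall>j\<in>{1..J}.
        distr \<Omega> (borel \<Otimes>\<^sub>M D) (\<lambda>\<omega>. (v r j \<omega>, \<xi> r j \<omega>)) = unif_sphere \<Otimes>\<^sub>M D)"

text \<open>The randomness used before step \<open>r\<close>, as a sub-\<open>\<sigma>\<close>-algebra of \<open>\<Omega>\<close>.\<close>

definition past ::
  "'w measure \<Rightarrow> 'e measure \<Rightarrow> nat \<Rightarrow> (nat \<Rightarrow> nat \<Rightarrow> 'w \<Rightarrow> real^'n) \<Rightarrow> (nat \<Rightarrow> nat \<Rightarrow> 'w \<Rightarrow> 'e)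
   \<Rightarrow> nat \<Rightarrow> 'w measure"
where
  "past \<Omega> D J v \<xi> r =
     vimage_algebra (space \<Omega>)
       (\<lambda>\<omega>. \<lambda>(s, j)\<in>{..<r} \<times> {1..J}. (v s j \<omega>, \<xi> s j \<omega>))
       (PiM ({..<r} \<times> {1..J}) (\<lambda>_. borel \<Otimes>\<^sub>M D))"

definition pzo_pda ::
  "'w measure \<Rightarrow> real^'n^'m \<Rightarrow> real^'n^'m \<Rightarrow> real^'m \<Rightarrow> (real^'n) set \<Rightarrow> (real^'n \<Rightarrow> real)
   \<Rightarrow> real \<Rightarrow> real \<Rightarrow> real \<Rightarrow> (nat \<Rightarrow> 'w \<Rightarrow> real^'n) \<Rightarrow> real^'n \<Rightarrow> real^'m
   \<Rightarrow> (nat \<Rightarrow> 'w \<Rightarrow> real^'n) \<Rightarrow> (nat \<Rightarrow> 'w \<Rightarrow> real^'m) \<Rightarrow> bool"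
where
  "pzo_pda \<Omega> A B b X h \<rho> \<gamma> \<beta> G x0 l0 x l \<longleftrightarrow>
     (\<forall>\<omega>\<in>space \<Omega>. x 0 \<omega> = x0 \<and> l 0 \<omega> = l0 \<and>
        (\<forall>r. is_arg_min (pda_objective A B b h \<rho> \<gamma> \<beta> (G r \<omega>) (x r \<omega>) (l r \<omega>)) (\<lambda>z. z \<in> X)
               (x (Suc r) \<omega>) \<and>
             l (Suc r) \<omega> = (1 - \<rho> * \<gamma>) *\<^sub>R l r \<omega> + \<rho> *\<^sub>R (A *v x (Suc r) \<omega> - b)))"

text \<open>The quoted estimates on the gradient estimator. The second moment is an \<open>ennreal\<close>-valued
  conditional expectation, so that the bound includes its finiteness; the library has no
  vector-valued conditional expectation, hence the components in the first one.\<close>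

definition estimator_bounds ::
  "'w measure \<Rightarrow> (nat \<Rightarrow> 'w measure) \<Rightarrow> (nat \<Rightarrow> 'w \<Rightarrow> real^'n) \<Rightarrow> (real^'n \<Rightarrow> real^'n)
   \<Rightarrow> (nat \<Rightarrow> 'w \<Rightarrow> real^'n) \<Rightarrow> real \<Rightarrow> nat \<Rightarrow> bool"
where
  "estimator_bounds \<Omega> \<F> G gradf\<mu> x s2 J \<longleftrightarrow>
     (\<forall>r i. AE \<omega> in \<Omega>. real_cond_exp \<Omega> (\<F> r) (\<lambda>\<omega>. G r \<omega> $ i) \<omega> = gradf\<mu> (x r \<omega>) $ i) \<and>
     (\<forall>r. AE \<omega> in \<Omega>. nn_cond_exp \<Omega> (\<F> r) (\<lambda>\<omega>. ennreal ((norm (G r \<omega> - gradf\<mu> (x r \<omega>)))\<^sup>2)) \<omega>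
            \<le> ennreal (s2 / real J))"


text \<open>The library's \<open>indep_var\<close> requires both random variables to have the same value type.\<close>

definition independent_rvs ::
  "'w measure \<Rightarrow> 'a measure \<Rightarrow> ('w \<Rightarrow> 'a) \<Rightarrow> 'b measure \<Rightarrow> ('w \<Rightarrow> 'b) \<Rightarrow> bool"
where
  "independent_rvs \<Omega> S Y T Z \<longleftrightarrow>
     Y \<in> measurable \<Omega> S \<and> Z \<in> measurable \<Omega> T \<and>
     prob_space.indep_set \<Omega> {Y -` U \<inter> space \<Omega> | U. U \<in> sets S} {Z -` U \<inter> space \<Omega> | U. U \<in> sets T}"


section \<open>Potential function and optimality gap\<close>

definition potential_C ::
  "real^'n^'m \<Rightarrow> real^'m \<Rightarrow> (real^'n \<Rightarrow> real) \<Rightarrow> (real^'n \<Rightarrow> real) \<Rightarrow> real \<Rightarrow> real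
   \<Rightarrow> real^'n \<Rightarrow> real^'m \<Rightarrow> real"
where
  "potential_C A b f\<mu> h \<rho> \<gamma> x l =
     f\<mu> x + h x + ((1 - \<rho> * \<gamma>) *\<^sub>R l) \<bullet> (A *v x - b - \<gamma> *\<^sub>R l) + \<rho> / 2 * (norm (A *v x - b))\<^sup>2"

text \<open>\<open>xr\<close>, \<open>lr\<close> stand for the iterates at step \<open>r\<close> and \<open>xs\<close>, \<open>ls\<close> for those at step \<open>r + 1\<close>.\<close>

definition potential_Q ::
  "real^'n^'m \<Rightarrow> real^'n^'m \<Rightarrow> real^'m \<Rightarrow> (real^'n \<Rightarrow> real) \<Rightarrow> (real^'n \<Rightarrow> real)
   \<Rightarrow> real \<Rightarrow> real \<Rightarrow> real \<Rightarrow> real \<Rightarrow> real^'n \<Rightarrow> real^'m \<Rightarrow> real^'n \<Rightarrow> real^'m \<Rightarrow> real"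
where
  "potential_Q A B b f\<mu> h \<rho> \<gamma> \<beta> L\<mu> xr lr xs ls =
     potential_C A b f\<mu> h \<rho> \<gamma> xs ls + (1 - \<rho> * \<gamma>) * \<gamma> / 2 * (norm ls)\<^sup>2
     + 1 / 2 * ((1 - \<rho> * \<gamma>) / \<rho> * (norm (ls - lr))\<^sup>2
               + \<beta> * wnorm_sq (transpose B ** B) (xs - xr)
               + 3 * L\<mu>\<^sup>2 * (norm (xs - xr))\<^sup>2)"

definition indicator_fun :: "'a set \<Rightarrow> 'a \<Rightarrow> ereal" where
  "indicator_fun X z = (if z \<in> X then 0 else \<infinity>)"

definition prox :: "real \<Rightarrow> (real^'n \<Rightarrow> ereal) \<Rightarrow> real^'n \<Rightarrow> real^'n" where
  "prox \<beta> g x = (ARG_MIN (\<lambda>z. ereal (\<beta> / 2 * (norm (x - z))\<^sup>2) + g z) z. True)"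

definition optimality_gap ::
  "real^'n^'m \<Rightarrow> (real^'n) set \<Rightarrow> (real^'n \<Rightarrow> real^'n) \<Rightarrow> (real^'n \<Rightarrow> real) \<Rightarrow> real \<Rightarrow> real
   \<Rightarrow> real^'n \<Rightarrow> real^'m \<Rightarrow> real^'n \<Rightarrow> real^'m \<Rightarrow> real"
where
  "optimality_gap A X gradf h \<rho> \<beta> xr lr xs ls =
     (norm (xr - prox \<beta> (\<lambda>z. ereal (h z) + indicator_fun X z)
                   (xr - (1 / \<beta>) *\<^sub>R (gradf xr + transpose A *v lr))))\<^sup>2
     + 1 / \<beta>\<^sup>2 * (norm (xs - xr))\<^sup>2 + 1 / \<rho>\<^sup>2 * (norm (ls - lr))\<^sup>2"

end

theory Submission
  imports Defs
begin

text \<open>The proof is a potential argument along each trajectory, followed by taking expectations.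

Fix an outcome of the randomness and let \<open>e\<^sub>r\<close> be the error of the gradient estimate at step \<open>r\<close>. The
optimality conditions of steps \<open>r\<close> and \<open>r + 1\<close>, each tested at the iterate of the other step, and
the dual recursion give (\<open>potential_descent\<close>)
\<open>Q\<^sub>r\<^sub>+\<^sub>1 \<le> Q\<^sub>r - c (\<parallel>\<Delta>x\<parallel>\<^sup>2 + \<parallel>\<Delta>\<lambda>\<parallel>\<^sup>2) + O(\<parallel>e\<^sub>r\<parallel>\<^sup>2 + \<parallel>e\<^sub>r\<^sub>+\<^sub>1\<parallel>\<^sup>2)\<close>,
so the steps taken up to time \<open>R\<close> are paid for by \<open>Q\<^sub>0 - Q\<^sub>R\<close> and the errors. Everything on the
left-hand side of the theorem is then compared with these steps. The proximal optimality gap is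
bounded by one primal step, one dual step, the error and the gradient bias of the smoothing, because
the next iterate and the proximal point satisfy nearly the same variational inequality
(\<open>gap_bound\<close>). The residual of the constraint equals \<open>\<Delta>\<lambda> / \<rho> + \<gamma> \<lambda>\<close>. The dual iterate drifts from
\<open>\<lambda>\<^sub>1\<close> only by accumulated steps, which leaves \<open>\<gamma>\<^sup>2 \<parallel>\<lambda>\<^sub>1\<parallel>\<^sup>2\<close>; this is controlled by \<open>Q\<^sub>0\<close>, in which
\<open>\<parallel>\<lambda>\<^sub>1\<parallel>\<^sup>2\<close> has the coefficient \<open>\<gamma> / 2\<close> (\<open>potential_lower_bound\<close>, \<open>infeasibility_bound\<close>). Comparing
coefficients, the term \<open>2 Q\<^sub>0 / (R (1 - \<rho> \<gamma>))\<close> covers it precisely when \<open>\<gamma> R (1 - \<rho> \<gamma>) < 1\<close>. That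
condition bounds \<open>R\<close> in terms of the parameters, and since only finitely many integers qualify, it
holds with a uniform margin (\<open>discrete_slack\<close>); this is how the constants become independent of \<open>R\<close>.
The lemma \<open>pathwise_bound\<close> collects these estimates.

For the expectation, strong convexity of the subproblem keeps all iterates square-integrable
(\<open>step_bounded\<close>), so all expectations that occur are finite. The errors have second moment at most
\<open>s2 / R\<close>, and there are \<open>R + 1\<close> of them. The sampled index \<open>a\<close> is independent of the iterates but
need not be independent of the estimation errors. Averaging over \<open>a\<close> must therefore be done on the
merit function itself, which is a Borel function of the iterates because proximal maps are
nonexpansive; the pathwise bound is applied only after that.\<close>

section \<open>Convex minimisation and the proximal map\<close>

lemma nonneg_of_perturbation:
  fixes s k :: real
  assumes "\<And>t. 0 < t \<Longrightarrow> t \<le> 1 \<Longrightarrow> 0 \<le> s + t * k"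
  shows "0 \<le> s"
proof (rule tendsto_lowerbound)
  have "((\<lambda>t. s + t * k) \<longlongrightarrow> s + 0 * k) (at_right 0)"
    by (intro tendsto_intros)
  then show "((\<lambda>t. s + t * k) \<longlongrightarrow> s) (at_right 0)" by simp
  show "\<forall>\<^sub>F t in at_right 0. 0 \<le> s + t * k"
    unfolding eventually_at_right_field
    by (rule exI[of _ 1]) (use assms in auto)
qed simp

text \<open>Moving from the minimiser \<open>y\<close> a fraction \<open>t\<close> of the way to \<open>z\<close> cannot decrease the objective;
dividing by \<open>t\<close> and letting it tend to \<open>0\<close> removes the quadratic term. The smooth part enters only
through its expansion along this one segment, so the lemma serves both the subproblem of the
algorithm and the proximal map.\<close>

lemma minimizer_variational_inequality:
  fixes q h :: "'a::real_vector \<Rightarrow> real"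
  assumes "convex X" "convex_on UNIV h" "y \<in> X" "z \<in> X"
    and min: "\<And>w. w \<in> X \<Longrightarrow> q y + h y \<le> q w + h w"
    and expansion: "\<And>t. q (y + t *\<^sub>R (z - y)) = q y + t * s + t\<^sup>2 * k"
  shows "0 \<le> s + (h z - h y)"
proof (rule nonneg_of_perturbation)
  fix t :: real assume t: "0 < t" "t \<le> 1"
  have e: "y + t *\<^sub>R (z - y) = (1 - t) *\<^sub>R y + t *\<^sub>R z"
    by (simp add: algebra_simps)
  have "y + t *\<^sub>R (z - y) \<in> X"
    unfolding e using t assms by (intro convexD) auto
  from min[OF this] have "q y + h y \<le> q y + t * s + t\<^sup>2 * k + h (y + t *\<^sub>R (z - y))"
    by (simp add: expansion)
  moreover have "h (y + t *\<^sub>R (z - y)) \<le> (1 - t) * h y + t * h z"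
    unfolding e using t assms(2) by (intro convex_onD) auto
  ultimately have "0 \<le> t * (s + (h z - h y) + t * k)"
    by (simp add: algebra_simps power2_eq_square)
  then show "0 \<le> s + (h z - h y) + t * k"
    using t by (simp add: zero_le_mult_iff)
qed

text \<open>The proximal map is defined by choice, so it says nothing until a minimiser is known to exist. One
exists by compactness: \<open>h\<close> is continuous because it is convex and finite everywhere, and the
quadratic term confines the search to a ball.\<close>

lemma prox_minimizes:
  fixes x :: "real^'n"
  assumes X: "closed X" "X \<noteq> {}" and h: "convex_on UNIV h" and h0: "\<And>z. z \<in> X \<Longrightarrow> 0 \<le> h z"
    and \<beta>: "0 < \<beta>"
  defines "y \<equiv> prox \<beta> (\<lambda>z. ereal (h z) + indicator_fun X z) x"
  shows "y \<in> X" and "w \<in> X \<Longrightarrow> \<beta> / 2 * (norm (x - y))\<^sup>2 + h y \<le> \<beta> / 2 * (norm (x - w))\<^sup>2 + h w"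
proof -
  define q where "q z = \<beta> / 2 * (norm (x - z))\<^sup>2 + h z" for z
  define g where "g z = ereal (\<beta> / 2 * (norm (x - z))\<^sup>2) + (ereal (h z) + indicator_fun X z)" for z
  have g: "g z = (if z \<in> X then ereal (q z) else \<infinity>)" for z
    by (simp add: g_def q_def indicator_fun_def)
  have hc: "continuous_on S h" for S
    using convex_on_continuous[OF open_UNIV h] continuous_on_subset by blast
  obtain x1 where x1: "x1 \<in> X" using X by auto
  define \<delta> where "\<delta> = sqrt (2 * q x1 / \<beta>)"
  have q1: "0 \<le> q x1" using \<beta> h0[OF x1] by (simp add: q_def)
  have "\<delta>\<^sup>2 = 2 * q x1 / \<beta>" using q1 \<beta> by (simp add: \<delta>_def)
  then have \<delta>2: "\<beta> / 2 * \<delta>\<^sup>2 = q x1" using \<beta> by simp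
  have \<delta>0: "0 \<le> \<delta>" using q1 \<beta> by (simp add: \<delta>_def)
  \<comment> \<open>Since \<open>h\<close> is nonnegative on \<open>X\<close>, points outside this ball cannot improve on \<open>x1\<close>.\<close>
  have out: "q x1 \<le> q z" if "z \<in> X" "z \<notin> cball x \<delta>" for z
  proof -
    have "\<delta> \<le> norm (x - z)" using that by (simp add: dist_norm)
    then have "\<delta>\<^sup>2 \<le> (norm (x - z))\<^sup>2" using \<delta>0 by (intro power_mono)
    then have "\<beta> / 2 * \<delta>\<^sup>2 \<le> \<beta> / 2 * (norm (x - z))\<^sup>2" using \<beta> by (intro mult_left_mono) auto
    then show ?thesis using h0[OF that(1)] \<delta>2 by (simp add: q_def)
  qed
  have x1b: "x1 \<in> X \<inter> cball x \<delta>"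
  proof -
    have "\<beta> / 2 * (norm (x - x1))\<^sup>2 \<le> \<beta> / 2 * \<delta>\<^sup>2" using \<delta>2 h0[OF x1] by (simp add: q_def)
    then have "(norm (x - x1))\<^sup>2 \<le> \<delta>\<^sup>2" using \<beta> by simp
    then show ?thesis using x1 \<delta>0 power2_le_imp_le by (auto simp: dist_norm)
  qed
  have "compact (X \<inter> cball x \<delta>)" using X by (intro closed_Int_compact) auto
  moreover have "continuous_on (X \<inter> cball x \<delta>) q"
    unfolding q_def by (intro continuous_intros hc)
  ultimately obtain m where m: "m \<in> X \<inter> cball x \<delta>" "\<And>z. z \<in> X \<inter> cball x \<delta> \<Longrightarrow> q m \<le> q z"
    using continuous_attains_inf[of "X \<inter> cball x \<delta>" q] x1b by blast
  have mm: "q m \<le> q z" if "z \<in> X" for z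
    using m(2)[OF x1b] m(2)[of z] out[of z] that by fastforce
  have "is_arg_min g (\<lambda>z. True) m"
    using m(1) mm by (auto simp: is_arg_min_def g not_less)
  then have "is_arg_min g (\<lambda>z. True) (arg_min g (\<lambda>z. True))"
    unfolding arg_min_def by (rule someI)
  moreover have "arg_min g (\<lambda>z. True) = y"
    unfolding y_def prox_def g_def ..
  ultimately have y: "is_arg_min g (\<lambda>z. True) y" by simp
  then have "\<not> g x1 < g y" by (auto simp: is_arg_min_def)
  then show yX: "y \<in> X" using x1 by (auto simp: g split: if_splits)
  assume w: "w \<in> X"
  have "\<not> g w < g y" using y by (auto simp: is_arg_min_def)
  then show "\<beta> / 2 * (norm (x - y))\<^sup>2 + h y \<le> \<beta> / 2 * (norm (x - w))\<^sup>2 + h w"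
    using w yX by (auto simp: g q_def)
qed

lemma prox_variational_inequality:
  fixes x :: "real^'n"
  assumes X: "closed X" "convex X" "X \<noteq> {}" and h: "convex_on UNIV h" and h0: "\<And>z. z \<in> X \<Longrightarrow> 0 \<le> h z"
    and \<beta>: "0 < \<beta>" and z: "z \<in> X"
  defines "y \<equiv> prox \<beta> (\<lambda>z. ereal (h z) + indicator_fun X z) x"
  shows "0 \<le> \<beta> * ((y - x) \<bullet> (z - y)) + (h z - h y)"
proof (rule minimizer_variational_inequality[OF X(2) h _ z])
  show "y \<in> X" unfolding y_def by (rule prox_minimizes(1)[OF X(1,3) h h0 \<beta>])
  show "\<beta> / 2 * (norm (x - y))\<^sup>2 + h y \<le> \<beta> / 2 * (norm (x - w))\<^sup>2 + h w" if "w \<in> X" for w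
    unfolding y_def by (rule prox_minimizes(2)[OF X(1,3) h h0 \<beta> that])
  show "\<beta> / 2 * (norm (x - (y + t *\<^sub>R (z - y))))\<^sup>2
      = \<beta> / 2 * (norm (x - y))\<^sup>2 + t * (\<beta> * ((y - x) \<bullet> (z - y))) + t\<^sup>2 * (\<beta> / 2 * (norm (z - y))\<^sup>2)" for t
  proof -
    have "(norm (x - (y + t *\<^sub>R (z - y))))\<^sup>2 = (norm ((x - y) - t *\<^sub>R (z - y)))\<^sup>2"
      by (simp add: algebra_simps)
    also have "\<dots> = (norm (x - y))\<^sup>2 + 2 * t * ((y - x) \<bullet> (z - y)) + t\<^sup>2 * (norm (z - y))\<^sup>2"
      unfolding power2_norm_eq_inner
      by (simp add: inner_diff_left inner_diff_right inner_commute algebra_simps power2_eq_square)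
    finally show ?thesis by (simp add: field_simps)
  qed
qed

text \<open>Adding the variational inequalities of two proximal points cancels \<open>h\<close>. Continuity of the proximal
map is what later makes the optimality gap a random variable.\<close>

lemma prox_nonexpansive:
  fixes u v :: "real^'n"
  assumes X: "closed X" "convex X" "X \<noteq> {}" and h: "convex_on UNIV h" and h0: "\<And>z. z \<in> X \<Longrightarrow> 0 \<le> h z"
    and \<beta>: "0 < \<beta>"
  defines "P \<equiv> prox \<beta> (\<lambda>z. ereal (h z) + indicator_fun X z)"
  shows "norm (P u - P v) \<le> norm (u - v)"
proof -
  have PX: "P w \<in> X" for w unfolding P_def by (rule prox_minimizes(1)[OF X(1,3) h h0 \<beta>])
  have "0 \<le> \<beta> * ((P u - u) \<bullet> (P v - P u)) + (h (P v) - h (P u))"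
    using prox_variational_inequality[OF X h h0 \<beta> PX, of u v] by (simp add: P_def)
  moreover have "0 \<le> \<beta> * ((P v - v) \<bullet> (P u - P v)) + (h (P u) - h (P v))"
    using prox_variational_inequality[OF X h h0 \<beta> PX, of v u] by (simp add: P_def)
  ultimately have "0 \<le> \<beta> * ((P u - u) \<bullet> (P v - P u) + (P v - v) \<bullet> (P u - P v))"
    by (simp add: algebra_simps)
  then have "0 \<le> (P u - u) \<bullet> (P v - P u) + (P v - v) \<bullet> (P u - P v)"
    using \<beta> by (simp add: zero_le_mult_iff)
  then have "(norm (P u - P v))\<^sup>2 \<le> (u - v) \<bullet> (P u - P v)"
    unfolding power2_norm_eq_inner by (simp add: inner_diff_left inner_diff_right inner_commute)
  also have "\<dots> \<le> norm (u - v) * norm (P u - P v)" by (rule norm_cauchy_schwarz)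
  finally show ?thesis
    by (cases "norm (P u - P v) = 0") (auto simp: power2_eq_square)
qed

section \<open>Smooth functions and ball smoothing\<close>

lemma smooth_quadratic_bound:
  fixes f :: "'a::real_inner \<Rightarrow> real"
  assumes f: "\<And>x. GDERIV f x :> gf x" and lip: "C-lipschitz_on UNIV gf"
  shows "\<bar>f y - f x - gf x \<bullet> (y - x)\<bar> \<le> C * (norm (y - x))\<^sup>2"
proof -
  have C: "0 \<le> C" using lip by (rule lipschitz_on_nonneg)
  have "norm (f y - f x - (\<lambda>h. h \<bullet> gf x) (y - x)) \<le> norm (y - x) * (C * norm (y - x))"
  proof (rule differentiable_bound_linearization[where S="closed_segment x y" and f'="\<lambda>z h. h \<bullet> gf z"])
    show "x + t *\<^sub>R (y - x) \<in> closed_segment x y" if "t \<in> {0..1}" for t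
      using that by (auto simp: closed_segment_def algebra_simps intro!: exI[of _ t])
    show "(f has_derivative (\<lambda>h. h \<bullet> gf z)) (at z within closed_segment x y)" for z
      using f[of z] unfolding gderiv_def by (rule has_derivative_at_withinI)
    show "x \<in> closed_segment x y" by simp
    fix z assume z: "z \<in> closed_segment x y"
    have "dist (gf z) (gf x) \<le> C * dist z x" using lip by (intro lipschitz_onD) auto
    moreover have "norm (z - x) \<le> norm (y - x)"
      using segment_bound(1)[OF z] by (simp add: norm_minus_commute)
    ultimately have *: "norm (gf z - gf x) \<le> C * norm (y - x)"
      using C by (auto simp: dist_norm intro: order_trans mult_left_mono)
    show "onorm ((\<lambda>h. h \<bullet> gf z) - (\<lambda>h. h \<bullet> gf x)) \<le> C * norm (y - x)"
    proof (rule onorm_bound)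
      show "0 \<le> C * norm (y - x)" using C by simp
    next
      fix w
      have "norm (((\<lambda>h. h \<bullet> gf z) - (\<lambda>h. h \<bullet> gf x)) w) = \<bar>w \<bullet> (gf z - gf x)\<bar>"
        by (simp add: inner_diff_right)
      also have "\<dots> \<le> norm w * norm (gf z - gf x)" by (rule Cauchy_Schwarz_ineq2)
      also have "\<dots> \<le> norm w * (C * norm (y - x))" using * by (intro mult_left_mono) auto
      finally show "norm (((\<lambda>h. h \<bullet> gf z) - (\<lambda>h. h \<bullet> gf x)) w) \<le> C * norm (y - x) * norm w"
        by (simp add: mult_ac)
    qed
  qed
  then show ?thesis by (simp add: power2_eq_square mult_ac inner_commute)
qed

lemma emeasure_unit_ball: "emeasure lborel (cball 0 1 :: (real^'n) set) \<noteq> 0"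
  "emeasure lborel (cball 0 1 :: (real^'n) set) \<noteq> \<infinity>"
proof -
  have "emeasure lborel (ball 0 1 :: (real^'n) set) \<le> emeasure lborel (cball 0 1 :: (real^'n) set)"
    by (intro emeasure_mono) auto
  moreover have "emeasure lborel (ball 0 1 :: (real^'n) set) > 0"
    using emeasure_lborel_ball_finite[of "0::real^'n" 1] 
    by (simp add: emeasure_ball unit_ball_vol_pos)
  ultimately show "emeasure lborel (cball 0 1 :: (real^'n) set) \<noteq> 0" by auto
  show "emeasure lborel (cball 0 1 :: (real^'n) set) \<noteq> \<infinity>"
    using emeasure_lborel_cball_finite[of "0::real^'n" 1] by simp
qed

lemma prob_space_unif_ball: "prob_space unif_ball"
  unfolding unif_ball_def by (intro prob_space_uniform_measure emeasure_unit_ball)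

lemma unif_ball_reflect: "distr unif_ball borel uminus = (unif_ball :: (real^'n) measure)"
proof (rule measure_eqI)
  show "sets (distr unif_ball borel uminus) = sets (unif_ball :: (real^'n) measure)"
    by (simp add: unif_ball_def)
  fix S :: "(real^'n) set" assume "S \<in> sets (distr unif_ball borel uminus)"
  then have S[measurable]: "S \<in> sets borel" by simp
  have refl: "emeasure lborel (uminus -` U) = emeasure lborel U" if U[measurable]: "U \<in> sets borel"
    for U :: "(real^'n) set"
  proof -
    have "emeasure lborel U = emeasure (distr lborel borel (\<lambda>x::real^'n. - x)) U"
      by (subst lborel_affine[of "-1" 0]) (simp_all add: density_1 one_ennreal_def[symmetric])
    also have "\<dots> = emeasure lborel (uminus -` U)" by (subst emeasure_distr) auto
    finally show ?thesis by simp
  qed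
  have "uminus -` S \<in> sets (borel :: (real^'n) measure)"
    using measurable_sets[of uminus borel borel S] by simp
  then have "emeasure (distr unif_ball borel uminus) S
      = emeasure lborel (cball 0 1 \<inter> uminus -` S) / emeasure lborel (cball 0 1 :: (real^'n) set)"
    by (subst emeasure_distr) (auto simp: unif_ball_def)
  also have "cball 0 1 \<inter> uminus -` S = uminus -` (cball 0 1 \<inter> S)" by auto
  also have "emeasure lborel (uminus -` (cball 0 1 \<inter> S)) = emeasure lborel (cball 0 1 \<inter> S)"
    by (intro refl) auto
  finally show "emeasure (distr unif_ball borel uminus) S = emeasure unif_ball S"
    by (simp add: unif_ball_def)
qed

text \<open>Since \<open>f\<close> is nonnegative on the feasible set, this bounds the smoothed function from below there. The
error is of order \<open>\<mu>\<^sup>2\<close>, which the variance proxy can absorb; the bound of order \<open>\<mu>\<close> that the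
boundedness of the gradient would give could not be absorbed.\<close>

lemma smoothing_lower_bound:
  fixes f :: "real^'n \<Rightarrow> real"
  assumes f: "\<And>x. GDERIV f x :> gf x" and lip: "C-lipschitz_on UNIV gf"
  shows "f x - C * \<mu>\<^sup>2 \<le> smoothing \<mu> f x"
proof -
  interpret U: prob_space "unif_ball :: (real^'n) measure" by (rule prob_space_unif_ball)
  have C: "0 \<le> C" using lip by (rule lipschitz_on_nonneg)
  have fc: "continuous_on S f" for S
    using f by (intro continuous_at_imp_continuous_on ballI has_derivative_continuous)
       (auto simp: gderiv_def)
  have sets[measurable_cong]: "sets (unif_ball :: (real^'n) measure) = sets borel"
    by (simp add: unif_ball_def)
  have AE: "AE v in unif_ball. norm (v :: real^'n) \<le> 1"
    unfolding unif_ball_def by (rule AE_uniform_measureI) auto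
  have int: "integrable unif_ball (\<lambda>v. f (x + (c * \<mu>) *\<^sub>R v))" for c
  proof -
    have "compact ((\<lambda>v. f (x + (c * \<mu>) *\<^sub>R v)) ` cball 0 1)"
      by (intro compact_continuous_image continuous_on_compose2[OF fc[of UNIV]] continuous_intros) auto
    then obtain M where M: "\<And>v. norm v \<le> 1 \<Longrightarrow> norm (f (x + (c * \<mu>) *\<^sub>R v)) \<le> M"
      using compact_imp_bounded bounded_iff by (metis (mono_tags, lifting) image_eqI mem_cball_0)
    have [measurable]: "f \<in> borel_measurable borel"
      by (intro borel_measurable_continuous_onI fc)
    show ?thesis
      by (rule U.integrable_const_bound[where B=M]) (use AE M in \<open>auto elim!: eventually_mono\<close>)
  qed
  note i1 = int[of 1, simplified] and i2 = int[of "-1", simplified]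
  \<comment> \<open>The linear term of the expansion at \<open>x\<close> cancels between \<open>v\<close> and its mirror image \<open>- v\<close>.\<close>
  have pw: "2 * (f x - C * \<mu>\<^sup>2) \<le> f (x + \<mu> *\<^sub>R v) + f (x + - \<mu> *\<^sub>R v)" if "norm v \<le> 1" for v
  proof -
    have "norm (\<mu> *\<^sub>R v) \<le> \<bar>\<mu>\<bar> * 1" using that by (simp add: mult_left_le)
    then have "(norm (\<mu> *\<^sub>R v))\<^sup>2 \<le> \<bar>\<mu>\<bar>\<^sup>2" by (intro power_mono) auto
    then have "C * (norm (\<mu> *\<^sub>R v))\<^sup>2 \<le> C * \<mu>\<^sup>2" using C by (intro mult_left_mono) auto
    then show ?thesis
      using smooth_quadratic_bound[OF f lip, of "x + \<mu> *\<^sub>R v" x]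
        smooth_quadratic_bound[OF f lip, of "x + - \<mu> *\<^sub>R v" x] by (auto simp: abs_le_iff)
  qed
  have "smoothing \<mu> f x = (\<integral>v. f (x + \<mu> *\<^sub>R v) \<partial>distr unif_ball borel uminus)"
    unfolding smoothing_def unif_ball_reflect ..
  also have "\<dots> = (\<integral>v. f (x + - \<mu> *\<^sub>R v) \<partial>unif_ball)"
  proof (subst integral_distr)
    show "uminus \<in> measurable (unif_ball :: (real^'n) measure) borel" by simp
    show "(\<lambda>v. f (x + \<mu> *\<^sub>R v)) \<in> borel_measurable borel"
      by (intro borel_measurable_continuous_onI continuous_on_compose2[OF fc[of UNIV]] continuous_intros) auto
  qed simp
  finally have "2 * smoothing \<mu> f x = (\<integral>v. f (x + \<mu> *\<^sub>R v) + f (x + - \<mu> *\<^sub>R v) \<partial>unif_ball)"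
    using i1 i2 by (simp add: smoothing_def)
  also have "\<dots> \<ge> (\<integral>v. 2 * (f x - C * \<mu>\<^sup>2) \<partial>(unif_ball :: (real^'n) measure))"
    using i1 i2 AE pw by (intro integral_mono_AE) (auto elim!: eventually_mono)
  finally show ?thesis by (simp add: U.prob_space)
qed


section \<open>Matrix weights and elementary inequalities\<close>

lemma wnorm_sq_gram: "wnorm_sq (transpose B ** B) v = (norm (B *v v))\<^sup>2"
  unfolding wnorm_sq_def power2_norm_eq_inner matrix_vector_mul_assoc[symmetric]
  by (subst inner_commute) (simp add: dot_lmul_matrix)

lemma inner_transpose_mult: "(transpose A *v y) \<bullet> u = y \<bullet> (A *v (u::real^'n))"
  by (simp add: dot_lmul_matrix)

lemma psd_gram_lower_bound:
  fixes A B :: "real^'n^'m"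
  assumes "psd (transpose A ** A + transpose B ** B - mat 1)"
  shows "(norm u)\<^sup>2 \<le> (norm (A *v u))\<^sup>2 + (norm (B *v u))\<^sup>2"
proof -
  have "0 \<le> u \<bullet> ((transpose A ** A + transpose B ** B - mat 1) *v u)"
    using assms by (simp add: psd_def)
  also have "\<dots> = wnorm_sq (transpose A ** A) u + wnorm_sq (transpose B ** B) u - u \<bullet> u"
    by (simp add: wnorm_sq_def matrix_vector_mult_add_rdistrib matrix_vector_mult_diff_rdistrib
        inner_add_right inner_diff_right)
  finally show ?thesis by (simp add: wnorm_sq_gram power2_norm_eq_inner)
qed

lemma sum_sq_le2: "(a + b)\<^sup>2 \<le> 2 * (a\<^sup>2 + (b::real)\<^sup>2)"
  using zero_le_power2[of "a - b"] by (simp add: power2_eq_square algebra_simps)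

lemma sum_sq_le4: "(a + b + c + d)\<^sup>2 \<le> 4 * (a\<^sup>2 + b\<^sup>2 + c\<^sup>2 + (d::real)\<^sup>2)"
  using sum_sq_le2[of "a + b" "c + d"] sum_sq_le2[of a b] sum_sq_le2[of c d]
  by (simp add: add.assoc)

lemma young:
  fixes u v :: real
  assumes "0 < c"
  shows "u * v \<le> c / 2 * u\<^sup>2 + v\<^sup>2 / (2 * c)"
proof -
  have "0 \<le> (c * u - v)\<^sup>2 / (2 * c)" using assms by simp
  also have "\<dots> = c / 2 * u\<^sup>2 + v\<^sup>2 / (2 * c) - u * v"
    using assms by (simp add: field_simps power2_eq_square)
  finally show ?thesis by simp
qed

lemma norm_add_sq_le:
  fixes u v :: "'a::real_inner"
  assumes "0 < \<epsilon>"
  shows "(norm (u + v))\<^sup>2 \<le> (1 + \<epsilon>) * (norm u)\<^sup>2 + (1 + 1 / \<epsilon>) * (norm v)\<^sup>2"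
proof -
  have "(norm (u + v))\<^sup>2 \<le> (norm u + norm v)\<^sup>2"
    by (intro power_mono norm_triangle_ineq) auto
  also have "\<dots> = (norm u)\<^sup>2 + (norm v)\<^sup>2 + 2 * (norm u * norm v)"
    by (simp add: power2_eq_square algebra_simps)
  also have "\<dots> \<le> (norm u)\<^sup>2 + (norm v)\<^sup>2 + 2 * (\<epsilon> / 2 * (norm u)\<^sup>2 + (norm v)\<^sup>2 / (2 * \<epsilon>))"
    using young[OF assms, of "norm u" "norm v"] by simp
  also have "\<dots> = (1 + \<epsilon>) * (norm u)\<^sup>2 + (1 + 1 / \<epsilon>) * (norm v)\<^sup>2"
    using assms by (simp add: field_simps)
  finally show ?thesis .
qed

section \<open>One step of the algorithm\<close>

text \<open>The layers of locales separate what constants may depend on. Every constant in the final estimate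
is defined in this first one and so depends only on the matrices and the parameters. The letter \<open>\<Lambda>\<close>
stands for the Lipschitz constant of the gradient of the smoothed function, which is called \<open>\<phi>\<close>.\<close>

locale pda_params =
  fixes A B :: "real^'n^'m" and \<rho> \<gamma> \<beta> \<Lambda> :: real
  assumes gram: "\<And>u. (norm u)\<^sup>2 \<le> (norm (A *v u))\<^sup>2 + (norm (B *v u))\<^sup>2"
    and pos: "0 < \<rho>" "0 < \<gamma>" "0 < \<beta>"
    and damping: "\<rho> * \<gamma> < 1"
    and \<rho>_ge_\<beta>: "\<beta> \<le> \<rho>"
    and dual_margin: "0 < (1 - \<rho> * \<gamma>) * \<gamma> / 2 + \<gamma> - (1 - \<rho> * \<gamma>) / \<rho>"
    and primal_margin: "(3 + 3 * \<Lambda>) * \<Lambda> + 2 < \<beta>"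
begin

definition kA where "kA = onorm ((*v) A)"
definition kB where "kB = onorm ((*v) B)"

lemma kA: "norm (A *v u) \<le> kA * norm u" and kA_nonneg: "0 \<le> kA"
  unfolding kA_def by (auto intro!: onorm onorm_pos_le)

lemma kB: "norm (B *v u) \<le> kB * norm u" and kB_nonneg: "0 \<le> kB"
  unfolding kB_def by (auto intro!: onorm onorm_pos_le)

lemma inner_B_le: "\<bar>(B *v u) \<bullet> (B *v w)\<bar> \<le> kB\<^sup>2 * (norm u * norm w)"
proof -
  have "\<bar>(B *v u) \<bullet> (B *v w)\<bar> \<le> norm (B *v u) * norm (B *v w)" by (rule Cauchy_Schwarz_ineq2)
  also have "\<dots> \<le> (kB * norm u) * (kB * norm w)"
    by (intro mult_mono kB) (auto simp: kB_nonneg)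
  finally show ?thesis by (simp add: power2_eq_square mult_ac)
qed

lemma inner_A_le: "\<bar>y \<bullet> (A *v w)\<bar> \<le> kA * (norm y * norm w)"
proof -
  have "\<bar>y \<bullet> (A *v w)\<bar> \<le> norm y * norm (A *v w)" by (rule Cauchy_Schwarz_ineq2)
  also have "\<dots> \<le> norm y * (kA * norm w)" by (intro mult_left_mono kA) auto
  finally show ?thesis by (simp add: mult_ac)
qed

end

locale pda_problem = pda_params A B \<rho> \<gamma> \<beta> \<Lambda>
  for A B :: "real^'n^'m" and \<rho> \<gamma> \<beta> \<Lambda> :: real +
  fixes b :: "real^'m" and X :: "(real^'n) set" and h \<phi> :: "real^'n \<Rightarrow> real"
    and g\<phi> :: "real^'n \<Rightarrow> real^'n"
  assumes closed_X: "closed X" and convex_X: "convex X"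
    and convex_h: "convex_on UNIV h" and h_nonneg: "\<And>z. z \<in> X \<Longrightarrow> 0 \<le> h z"
    and grad: "\<And>z. GDERIV \<phi> z :> g\<phi> z" and lip: "\<Lambda>-lipschitz_on UNIV g\<phi>"
begin

lemma \<Lambda>_nonneg: "0 \<le> \<Lambda>" using lip by (rule lipschitz_on_nonneg)

lemma grad_lip: "norm (g\<phi> u - g\<phi> w) \<le> \<Lambda> * norm (u - w)"
  using lipschitz_onD[OF lip, of u w] by (simp add: dist_norm)

lemma step_variational_inequality:
  assumes step: "is_arg_min (pda_objective A B b h \<rho> \<gamma> \<beta> g xr lr) (\<lambda>z. z \<in> X) x'"
    and z: "z \<in> X"
  defines "l' \<equiv> (1 - \<rho> * \<gamma>) *\<^sub>R lr + \<rho> *\<^sub>R (A *v x' - b)"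
  shows "0 \<le> g \<bullet> (z - x') + l' \<bullet> (A *v (z - x')) + \<beta> * ((B *v (x' - xr)) \<bullet> (B *v (z - x')))
    + (h z - h x')"
proof (rule minimizer_variational_inequality[OF convex_X convex_h _ z])
  define q where "q w = pda_objective A B b (\<lambda>_. 0) \<rho> \<gamma> \<beta> g xr lr w" for w
  have q: "pda_objective A B b h \<rho> \<gamma> \<beta> g xr lr w = q w + h w" for w
    by (simp add: q_def pda_objective_def)
  show "x' \<in> X" using step by (simp add: is_arg_min_def)
  show "q x' + h x' \<le> q w + h w" if "w \<in> X" for w
    using step that by (auto simp: is_arg_min_def q not_less)
  define u where "u = A *v (z - x')"
  define w where "w = B *v (z - x')"
  show "q (x' + t *\<^sub>R (z - x')) = q x' + t * (g \<bullet> (z - x') + l' \<bullet> (A *v (z - x'))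
        + \<beta> * ((B *v (x' - xr)) \<bullet> (B *v (z - x')))) + t\<^sup>2 * (\<rho> / 2 * (norm u)\<^sup>2 + \<beta> / 2 * (norm w)\<^sup>2)"
    for t
  proof -
    have a: "A *v (x' + t *\<^sub>R (z - x')) - b = (A *v x' - b) + t *\<^sub>R u"
      by (simp add: u_def matrix_vector_right_distrib matrix_vector_mult_scaleR)
    have c: "B *v (x' + t *\<^sub>R (z - x') - xr) = B *v (x' - xr) + t *\<^sub>R w"
      by (simp add: w_def algebra_simps)
    have d: "x' + t *\<^sub>R (z - x') - xr = (x' - xr) + t *\<^sub>R (z - x')" by simp
    define p where "p = A *v x' - b"
    define s where "s = B *v (x' - xr)"
    show ?thesis
      unfolding q_def pda_objective_def wnorm_sq_gram a c l'_def u_def[symmetric] w_def[symmetric]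
        p_def[symmetric] s_def[symmetric] power2_norm_eq_inner
      unfolding d
      by (simp add: inner_add_left inner_add_right inner_diff_left inner_diff_right inner_commute
          power2_eq_square field_simps)
  qed
qed

text \<open>One iteration maps square-integrable iterates to square-integrable ones: the step objective is
  strongly convex because \<open>A\<^sup>T A + B\<^sup>T B\<close> dominates the identity, so its minimiser stays within a
  distance of a fixed feasible point that is linear in the data of the step.\<close>

lemma step_bounded:
  assumes z: "z \<in> X"
  shows "\<exists>k\<ge>0. \<forall>g xr lr x'. is_arg_min (pda_objective A B b h \<rho> \<gamma> \<beta> g xr lr) (\<lambda>z. z \<in> X) x' \<longrightarrow>
    (norm (x' - z))\<^sup>2 + h x' \<le> k * (1 + (norm (xr - z))\<^sup>2 + (norm lr)\<^sup>2 + (norm (g - g\<phi> xr))\<^sup>2)"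
proof -
  define n where "n = 1 + norm (g\<phi> z) + kA * \<rho> * norm (A *v z - b) + kA + \<Lambda> + \<beta> * kB\<^sup>2"
  define C where "C = h z + 2 * n\<^sup>2 / \<beta>"
  define k where "k = (2 / \<beta> + 1) * C"
  have n1: "0 \<le> n" using kA_nonneg kB_nonneg \<Lambda>_nonneg pos by (auto simp: n_def)
  have C0: "0 \<le> C" using h_nonneg[OF z] pos by (simp add: C_def)
  have k0: "0 \<le> k" using C0 pos by (simp add: k_def)
  have main: "(norm (x' - z))\<^sup>2 + h x' \<le> k * (1 + (norm (xr - z))\<^sup>2 + (norm lr)\<^sup>2 + (norm (g - g\<phi> xr))\<^sup>2)"
    if step: "is_arg_min (pda_objective A B b h \<rho> \<gamma> \<beta> g xr lr) (\<lambda>z. z \<in> X) x'" for g xr lr x'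
  proof -
    define u where "u = x' - z"
    define pz where "pz = A *v z - b"
    define W where "W = 1 + (norm (xr - z))\<^sup>2 + (norm lr)\<^sup>2 + (norm (g - g\<phi> xr))\<^sup>2"
    define N where "N = norm g + kA * (norm lr + \<rho> * norm pz) + \<beta> * kB\<^sup>2 * norm (xr - z)"
    have x': "x' \<in> X" using step by (simp add: is_arg_min_def)
    have hx: "0 \<le> h x'" by (rule h_nonneg[OF x'])
    have Az: "A *v x' - b = A *v u + pz"
      by (simp add: u_def pz_def algebra_simps)
    have Bz: "B *v (x' - xr) = B *v u + B *v (z - xr)"
      by (simp add: u_def algebra_simps)
    have zx: "z - x' = - u" by (simp add: u_def)
    have m: "M *v (- u) = - (M *v u)" for M :: "real^'n^'m"
      using matrix_vector_mult_scaleR[of M "-1" u] by simp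
    have vi: "\<rho> * (norm (A *v u))\<^sup>2 + \<beta> * (norm (B *v u))\<^sup>2 + h x'
        \<le> h z - g \<bullet> u - (1 - \<rho> * \<gamma>) * (lr \<bullet> (A *v u)) - \<rho> * (pz \<bullet> (A *v u))
          - \<beta> * ((B *v (z - xr)) \<bullet> (B *v u))"
      using step_variational_inequality[OF step z]
      unfolding Az Bz zx m power2_norm_eq_inner
      by (simp add: inner_add_left inner_add_right algebra_simps)
    have t1: "- (g \<bullet> u) \<le> norm g * norm u"
      using Cauchy_Schwarz_ineq2[of g u] by linarith
    have t2: "- ((1 - \<rho> * \<gamma>) * (lr \<bullet> (A *v u))) \<le> kA * (norm lr * norm u)"
    proof -
      have "- ((1 - \<rho> * \<gamma>) * (lr \<bullet> (A *v u))) \<le> \<bar>(1 - \<rho> * \<gamma>) * (lr \<bullet> (A *v u))\<bar>" by linarith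
      also have "\<dots> = (1 - \<rho> * \<gamma>) * \<bar>lr \<bullet> (A *v u)\<bar>" using damping by (simp add: abs_mult)
      also have "\<dots> \<le> 1 * \<bar>lr \<bullet> (A *v u)\<bar>" using pos by (intro mult_right_mono) auto
      finally show ?thesis using inner_A_le[of lr u] by linarith
    qed
    have t3: "- (\<rho> * (pz \<bullet> (A *v u))) \<le> \<rho> * (kA * (norm pz * norm u))"
    proof -
      have "- (pz \<bullet> (A *v u)) \<le> kA * (norm pz * norm u)" using inner_A_le[of pz u] by linarith
      then have "\<rho> * - (pz \<bullet> (A *v u)) \<le> \<rho> * (kA * (norm pz * norm u))"
        using pos by (intro mult_left_mono) auto
      then show ?thesis by simp
    qed
    have t4: "- (\<beta> * ((B *v (z - xr)) \<bullet> (B *v u))) \<le> \<beta> * (kB\<^sup>2 * (norm (xr - z) * norm u))"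
    proof -
      have "- ((B *v (z - xr)) \<bullet> (B *v u)) \<le> kB\<^sup>2 * (norm (xr - z) * norm u)"
        using inner_B_le[of "z - xr" u] by (simp add: norm_minus_commute)
      then have "\<beta> * - ((B *v (z - xr)) \<bullet> (B *v u)) \<le> \<beta> * (kB\<^sup>2 * (norm (xr - z) * norm u))"
        using pos by (intro mult_left_mono) auto
      then show ?thesis by simp
    qed
    have "\<beta> * (norm u)\<^sup>2 \<le> \<beta> * ((norm (A *v u))\<^sup>2 + (norm (B *v u))\<^sup>2)"
      using gram[of u] pos by (intro mult_left_mono) auto
    also have "\<dots> \<le> \<rho> * (norm (A *v u))\<^sup>2 + \<beta> * (norm (B *v u))\<^sup>2"
      using \<rho>_ge_\<beta> by (simp add: algebra_simps mult_right_mono)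
    finally have "\<beta> * (norm u)\<^sup>2 + h x' \<le> h z + N * norm u"
      using vi t1 t2 t3 t4 by (simp add: N_def algebra_simps)
    also have "N * norm u = norm u * N" by simp
    also have "\<dots> \<le> \<beta> / 2 * (norm u)\<^sup>2 + N\<^sup>2 / (2 * \<beta>)" by (rule young[OF pos(3)])
    finally have b1: "\<beta> / 2 * (norm u)\<^sup>2 + h x' \<le> h z + N\<^sup>2 / (2 * \<beta>)" by simp
    have W: "1 \<le> W" by (simp add: W_def)
    have "norm g \<le> norm (g - g\<phi> xr) + norm (g\<phi> xr - g\<phi> z) + norm (g\<phi> z)"
      using norm_triangle_ineq[of "g - g\<phi> xr" "g\<phi> xr"] norm_triangle_ineq[of "g\<phi> xr - g\<phi> z" "g\<phi> z"]
      by simp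
    then have "N \<le> norm (g - g\<phi> xr) + (norm (g\<phi> z) + kA * \<rho> * norm pz)
        + kA * norm lr + (\<Lambda> + \<beta> * kB\<^sup>2) * norm (xr - z)"
      using grad_lip[of xr z] by (simp add: N_def algebra_simps)
    also have "\<dots> \<le> n * norm (g - g\<phi> xr) + n * 1 + n * norm lr + n * norm (xr - z)"
    proof (intro add_mono)
      have parts: "0 \<le> norm (g\<phi> z)" "0 \<le> kA * \<rho> * norm pz" "0 \<le> kA" "0 \<le> \<Lambda>" "0 \<le> \<beta> * kB\<^sup>2"
        using kA_nonneg \<Lambda>_nonneg pos by auto
      have n: "n = 1 + norm (g\<phi> z) + kA * \<rho> * norm pz + kA + \<Lambda> + \<beta> * kB\<^sup>2"
        by (simp add: n_def pz_def)
      have "1 \<le> n" using parts unfolding n by linarith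
      then show "norm (g - g\<phi> xr) \<le> n * norm (g - g\<phi> xr)"
        using mult_right_mono[of 1 n "norm (g - g\<phi> xr)"] by simp
      show "norm (g\<phi> z) + kA * \<rho> * norm pz \<le> n * 1" using parts
        by (simp only: n mult_1_right)
      show "kA * norm lr \<le> n * norm lr"
        using parts by (intro mult_right_mono) (auto simp: n)
      show "(\<Lambda> + \<beta> * kB\<^sup>2) * norm (xr - z) \<le> n * norm (xr - z)"
        using parts by (intro mult_right_mono) (auto simp: n)
    qed
    also have "\<dots> = n * (1 + norm (xr - z) + norm lr + norm (g - g\<phi> xr))"
      by (simp add: algebra_simps)
    finally have Nn: "N \<le> n * (1 + norm (xr - z) + norm lr + norm (g - g\<phi> xr))" .
    have "0 \<le> N" using kA_nonneg kB_nonneg pos by (simp add: N_def)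
    then have "N\<^sup>2 \<le> (n * (1 + norm (xr - z) + norm lr + norm (g - g\<phi> xr)))\<^sup>2"
      using Nn by (intro power_mono)
    also have "\<dots> \<le> n\<^sup>2 * (4 * W)"
      using sum_sq_le4[of 1 "norm (xr - z)" "norm lr" "norm (g - g\<phi> xr)"]
      unfolding power_mult_distrib W_def by (intro mult_left_mono) auto
    finally have "N\<^sup>2 / (2 * \<beta>) \<le> 2 * n\<^sup>2 / \<beta> * W"
      using pos by (simp add: field_simps)
    moreover have "h z \<le> h z * W" using h_nonneg[OF z] W by (simp add: mult_left_le mult_le_cancel_left1)
    ultimately have b2: "\<beta> / 2 * (norm u)\<^sup>2 + h x' \<le> C * W"
      using b1 by (simp add: C_def algebra_simps)
    then have "h x' \<le> C * W" using pos by (smt (verit) zero_le_power2 mult_nonneg_nonneg half_gt_zero)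
    moreover have "(norm u)\<^sup>2 \<le> 2 / \<beta> * (C * W)"
      using b2 hx pos by (simp add: field_simps)
    ultimately show ?thesis unfolding W_def[symmetric] u_def[symmetric] k_def
      by (simp add: algebra_simps)
  qed
  show ?thesis by (rule exI[of _ k]) (use k0 main in blast)
qed

end

section \<open>Descent of the potential along a trajectory\<close>

text \<open>Written in terms of \<open>m = (\<lambda>' - \<lambda>) / \<rho>\<close>, the dual update reads \<open>\<lambda>' = \<lambda> + \<rho> m\<close> with residual
  \<open>p' = \<gamma> \<lambda> + m\<close>, and both changes of the potential become polynomial identities.\<close>

lemma potential_change_identity:
  fixes y m q :: "'a::real_inner"
  assumes p': "p' = \<gamma> *\<^sub>R y + m" and y': "y' = y + \<rho> *\<^sub>R m"
  shows "(1 - \<rho> * \<gamma>) * (y' \<bullet> (p' - \<gamma> *\<^sub>R y')) + \<rho> / 2 * (norm p')\<^sup>2 + (1 - \<rho> * \<gamma>) * \<gamma> / 2 * (norm y')\<^sup>2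
     - ((1 - \<rho> * \<gamma>) * (y \<bullet> (p' - q - \<gamma> *\<^sub>R y)) + \<rho> / 2 * (norm (p' - q))\<^sup>2
        + (1 - \<rho> * \<gamma>) * \<gamma> / 2 * (norm y)\<^sup>2)
   = y' \<bullet> q - \<rho> / 2 * (norm q)\<^sup>2 + (1 - \<rho> * \<gamma>) * (\<rho> - \<gamma> * \<rho>\<^sup>2 / 2) * (norm m)\<^sup>2"
  unfolding p' y' power2_norm_eq_inner
  by (simp add: inner_add_left inner_add_right inner_diff_left inner_diff_right inner_commute
      power2_eq_square) (simp add: field_simps)

lemma potential_value_identity:
  fixes y m :: "'a::real_inner"
  assumes p': "p' = \<gamma> *\<^sub>R y + m" and y': "y' = y + \<rho> *\<^sub>R m"
  shows "(1 - \<rho> * \<gamma>) * (y' \<bullet> (p' - \<gamma> *\<^sub>R y')) + \<rho> / 2 * (norm p')\<^sup>2 + (1 - \<rho> * \<gamma>) * \<gamma> / 2 * (norm y')\<^sup>2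
   = \<gamma> / 2 * (norm y')\<^sup>2 + (1 - \<rho> * \<gamma>) * (y' \<bullet> m) + \<rho> / 2 * (1 - \<rho> * \<gamma>)\<^sup>2 * (norm m)\<^sup>2"
  unfolding p' y' power2_norm_eq_inner
  by (simp add: inner_add_left inner_add_right inner_diff_left inner_diff_right inner_commute
      power2_eq_square) (simp add: field_simps)


text \<open>A single outcome of the algorithm: \<open>g r\<close> is an arbitrary vector in the role of the gradient estimate
at step \<open>r\<close>, and all bounds are in terms of its deviation \<open>err r\<close> from the gradient of \<open>\<phi>\<close>.\<close>

locale pda_path = pda_problem A B \<rho> \<gamma> \<beta> \<Lambda> b X h \<phi> g\<phi>
  for A B :: "real^'n^'m" and \<rho> \<gamma> \<beta> \<Lambda> :: real and b :: "real^'m" and X :: "(real^'n) set"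
    and h \<phi> :: "real^'n \<Rightarrow> real" and g\<phi> :: "real^'n \<Rightarrow> real^'n" +
  fixes g x :: "nat \<Rightarrow> real^'n" and l :: "nat \<Rightarrow> real^'m"
  assumes step: "\<And>r. is_arg_min (pda_objective A B b h \<rho> \<gamma> \<beta> (g r) (x r) (l r)) (\<lambda>z. z \<in> X) (x (Suc r))"
    and dual_step: "\<And>r. l (Suc r) = (1 - \<rho> * \<gamma>) *\<^sub>R l r + \<rho> *\<^sub>R (A *v x (Suc r) - b)"
begin

definition dx where "dx r = x (Suc r) - x r"
definition m where "m r = (1 / \<rho>) *\<^sub>R (l (Suc r) - l r)"
definition err where "err r = g r - g\<phi> (x r)"
definition Q where "Q r = potential_Q A B b \<phi> h \<rho> \<gamma> \<beta> \<Lambda> (x r) (l r) (x (Suc r)) (l (Suc r))"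
text \<open>The part of the potential that depends on the current iterate alone; \<open>Q r\<close> adds to it the squared
lengths of the last step.\<close>

definition P where "P r = \<phi> (x r) + h (x r) + ((1 - \<rho> * \<gamma>) * (l r \<bullet> (A *v x r - b - \<gamma> *\<^sub>R l r))
  + \<rho> / 2 * (norm (A *v x r - b))\<^sup>2 + (1 - \<rho> * \<gamma>) * \<gamma> / 2 * (norm (l r))\<^sup>2)"

lemma x_in: "x (Suc r) \<in> X" using step[of r] by (simp add: is_arg_min_def)

lemma dl: "l (Suc r) - l r = \<rho> *\<^sub>R m r" using pos by (simp add: m_def)

lemma l_Suc: "l (Suc r) = l r + \<rho> *\<^sub>R m r" using dl[of r] by (simp add: algebra_simps)

text \<open>The damping in the dual update turns the residual into a dual step plus a multiple of the dual
iterate itself. Hence small dual steps alone do not make the residual small.\<close>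

lemma residual: "A *v x (Suc r) - b = \<gamma> *\<^sub>R l r + m r"
proof -
  have "\<rho> *\<^sub>R (A *v x (Suc r) - b) = \<rho> *\<^sub>R (\<gamma> *\<^sub>R l r + m r)"
    using dual_step[of r] l_Suc[of r] by (simp add: algebra_simps)
  then show ?thesis using pos by (simp only: scaleR_cancel_left) auto
qed

lemma A_dx: "A *v dx (Suc r) = m (Suc r) - (1 - \<rho> * \<gamma>) *\<^sub>R m r"
proof -
  have "A *v dx (Suc r) = (A *v x (Suc (Suc r)) - b) - (A *v x (Suc r) - b)"
    by (simp add: dx_def algebra_simps)
  also have "\<dots> = m (Suc r) - (1 - \<rho> * \<gamma>) *\<^sub>R m r"
    unfolding residual l_Suc by (simp add: algebra_simps)
  finally show ?thesis .
qed

lemma variational_inequality: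
  "z \<in> X \<Longrightarrow> 0 \<le> g r \<bullet> (z - x (Suc r)) + l (Suc r) \<bullet> (A *v (z - x (Suc r)))
     + \<beta> * ((B *v dx r) \<bullet> (B *v (z - x (Suc r)))) + (h z - h (x (Suc r)))"
  using step_variational_inequality[OF step[of r]] unfolding dual_step[of r, symmetric] dx_def .

lemma Q_eq: "Q r = P (Suc r) + (1 - \<rho> * \<gamma>) * \<rho> / 2 * (norm (m r))\<^sup>2
    + \<beta> / 2 * (norm (B *v dx r))\<^sup>2 + 3 * \<Lambda>\<^sup>2 / 2 * (norm (dx r))\<^sup>2"
proof -
  have "(1 - \<rho> * \<gamma>) / \<rho> * (norm (l (Suc r) - l r))\<^sup>2 = (1 - \<rho> * \<gamma>) * \<rho> * (norm (m r))\<^sup>2"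
    unfolding dl using pos by (simp add: power_mult_distrib power2_eq_square)
  then show ?thesis
    unfolding Q_def potential_Q_def potential_C_def wnorm_sq_gram P_def dx_def by simp
qed

lemma P_change: "P (Suc r) - P r = \<phi> (x (Suc r)) - \<phi> (x r) + (h (x (Suc r)) - h (x r))
    + l (Suc r) \<bullet> (A *v dx r) - \<rho> / 2 * (norm (A *v dx r))\<^sup>2
    + (1 - \<rho> * \<gamma>) * (\<rho> - \<gamma> * \<rho>\<^sup>2 / 2) * (norm (m r))\<^sup>2"
proof -
  have e: "A *v x r - b = (A *v x (Suc r) - b) - A *v dx r"
    by (simp add: dx_def algebra_simps)
  show ?thesis
    using potential_change_identity[OF residual[of r] l_Suc[of r], where q="A *v dx r"]
    unfolding P_def e by linarith
qed

text \<open>Polarisation of \<open>A_dx\<close>. The left-hand side combines the change of the momentum term of the potential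
with a multiple of the squared dual step that is present thanks to the damping \<open>\<gamma> > 0\<close>; the
right-hand side is the cross term produced by comparing two consecutive optimality conditions.\<close>

lemma dual_momentum:
  "\<rho> * (1 - \<rho> * \<gamma>) / 2 * ((norm (m (Suc r)))\<^sup>2 - (norm (m r))\<^sup>2) + \<rho>\<^sup>2 * \<gamma> * (norm (m (Suc r)))\<^sup>2
    \<le> (l (Suc (Suc r)) - l (Suc r)) \<bullet> (A *v dx (Suc r))"
proof -
  have "(l (Suc (Suc r)) - l (Suc r)) \<bullet> (A *v dx (Suc r))
      = \<rho> * (1 - \<rho> * \<gamma>) / 2 * ((norm (m (Suc r)))\<^sup>2 - (norm (m r))\<^sup>2) + \<rho>\<^sup>2 * \<gamma> * (norm (m (Suc r)))\<^sup>2
        + \<rho> * (1 - \<rho> * \<gamma>) / 2 * (norm (m (Suc r) - m r))\<^sup>2"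
    unfolding dl A_dx power2_norm_eq_inner
    by (simp add: inner_diff_left inner_diff_right inner_add_left inner_add_right inner_commute
        power2_eq_square field_simps)
  then show ?thesis using damping pos by simp
qed

text \<open>Two inequalities are added. The optimality condition of the new step, tested at the old iterate,
makes the function value decrease up to a positive multiple of the squared dual step
(\<open>P_change\<close>). The difference of two consecutive optimality conditions bounds the growth of the
momentum terms and returns a negative multiple of the same quantity through \<open>dual_momentum\<close>. The
assumption \<open>dual_margin\<close> says that the negative multiple wins. The first iterate need not be
feasible, so there is no such comparison for step \<open>0\<close> and the descent starts at \<open>Q 0\<close>.\<close>

lemma potential_descent:
  "Q (Suc r) \<le> Q r
     - ((1 - \<rho> * \<gamma>) * \<gamma> / 2 + \<gamma> - (1 - \<rho> * \<gamma>) / \<rho>) * (norm (l (Suc (Suc r)) - l (Suc r)))\<^sup>2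
     - 1 / 6 * (norm (dx (Suc r)))\<^sup>2 + 2 * (norm (err (Suc r)))\<^sup>2 + 3 / 2 * (norm (err r))\<^sup>2"
proof -
  define d where "d = dx (Suc r)"
  define q where "q = A *v d"
  define \<mu>d where "\<mu>d = g\<phi> (x (Suc r)) - g\<phi> (x r)"
  have n1: "x (Suc r) - x (Suc (Suc r)) = - d" and n2: "x (Suc (Suc r)) - x (Suc r) = d"
    by (simp_all add: d_def dx_def)
  have neg: "M *v (- d) = - (M *v d)" for M :: "real^'n^'m"
    using matrix_vector_mult_scaleR[of M "-1" d] by simp
  have v1: "h (x (Suc (Suc r))) - h (x (Suc r)) + l (Suc (Suc r)) \<bullet> q
      \<le> - (g (Suc r) \<bullet> d) - \<beta> * (norm (B *v d))\<^sup>2"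
    using variational_inequality[OF x_in, of "Suc r" r] unfolding n1 neg power2_norm_eq_inner
    by (simp add: q_def d_def[symmetric])
  have v2: "0 \<le> g r \<bullet> d + l (Suc r) \<bullet> q + \<beta> * ((B *v dx r) \<bullet> (B *v d))
      + (h (x (Suc (Suc r))) - h (x (Suc r)))"
    using variational_inequality[OF x_in, of r "Suc r"] unfolding n2 by (simp add: q_def d_def)
  have gg: "g (Suc r) - g r = err (Suc r) - err r + \<mu>d" by (simp add: err_def \<mu>d_def)
  have \<mu>d: "norm \<mu>d \<le> \<Lambda> * norm (dx r)"
    using grad_lip unfolding \<mu>d_def dx_def by simp
  have v3: "(l (Suc (Suc r)) - l (Suc r)) \<bullet> q + \<beta> * ((norm (B *v d))\<^sup>2 - (B *v dx r) \<bullet> (B *v d))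
      \<le> - ((g (Suc r) - g r) \<bullet> d)"
    using v1 v2 by (simp add: inner_diff_left algebra_simps)
  have B: "\<beta> / 2 * ((norm (B *v d))\<^sup>2 - (norm (B *v dx r))\<^sup>2)
      \<le> \<beta> * ((norm (B *v d))\<^sup>2 - (B *v dx r) \<bullet> (B *v d))"
  proof -
    have "0 \<le> (norm (B *v d - B *v dx r))\<^sup>2" by simp
    also have "\<dots> = (norm (B *v d))\<^sup>2 + (norm (B *v dx r))\<^sup>2 - 2 * ((B *v dx r) \<bullet> (B *v d))"
      unfolding power2_norm_eq_inner
      by (simp add: inner_diff_left inner_diff_right inner_commute)
    finally have "((norm (B *v d))\<^sup>2 - (norm (B *v dx r))\<^sup>2) / 2 \<le> (norm (B *v d))\<^sup>2 - (B *v dx r) \<bullet> (B *v d)"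
      by simp
    then have "\<beta> * (((norm (B *v d))\<^sup>2 - (norm (B *v dx r))\<^sup>2) / 2)
        \<le> \<beta> * ((norm (B *v d))\<^sup>2 - (B *v dx r) \<bullet> (B *v d))"
      using pos by (intro mult_left_mono) auto
    then show ?thesis by simp
  qed
  have \<phi>: "\<phi> (x (Suc (Suc r))) - \<phi> (x (Suc r)) \<le> g\<phi> (x (Suc r)) \<bullet> d + \<Lambda> * (norm d)\<^sup>2"
    using smooth_quadratic_bound[OF grad lip, of "x (Suc (Suc r))" "x (Suc r)"]
    by (simp add: n2 abs_le_iff)
  have AB: "\<beta> / 2 * (norm d)\<^sup>2 \<le> \<rho> / 2 * (norm q)\<^sup>2 + \<beta> * (norm (B *v d))\<^sup>2"
  proof -
    have "\<beta> / 2 * (norm d)\<^sup>2 \<le> \<beta> / 2 * ((norm q)\<^sup>2 + (norm (B *v d))\<^sup>2)"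
      unfolding q_def using gram pos by (intro mult_left_mono) auto
    also have "\<dots> = \<beta> / 2 * (norm q)\<^sup>2 + \<beta> / 2 * (norm (B *v d))\<^sup>2" by (simp add: algebra_simps)
    also have "\<dots> \<le> \<rho> / 2 * (norm q)\<^sup>2 + \<beta> * (norm (B *v d))\<^sup>2"
      using \<rho>_ge_\<beta> pos by (intro add_mono mult_right_mono) auto
    finally show ?thesis .
  qed
  have e: "g (Suc r) \<bullet> d = err (Suc r) \<bullet> d + g\<phi> (x (Suc r)) \<bullet> d"
    by (simp add: err_def inner_diff_left)
  have gd: "(g (Suc r) - g r) \<bullet> d = err (Suc r) \<bullet> d - err r \<bullet> d + \<mu>d \<bullet> d"
    unfolding gg by (simp add: inner_diff_left inner_add_left)
  \<comment> \<open>The lower bound on \<open>\<beta>\<close> leaves more than \<open>1\<close> in \<open>\<beta> / 2\<close> after \<open>\<Lambda> + 3 / 2 * \<Lambda>\<^sup>2\<close>; the three products below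
    use \<open>5 / 6\<close> of it.\<close>
  have y1: "- 2 * (err (Suc r) \<bullet> d) \<le> 2 * (norm (err (Suc r)))\<^sup>2 + 1 / 2 * (norm d)\<^sup>2"
    using Cauchy_Schwarz_ineq2[of "err (Suc r)" d] young[of 2 "norm (err (Suc r))" "norm d"] by simp
  have y2: "err r \<bullet> d \<le> 3 / 2 * (norm (err r))\<^sup>2 + 1 / 6 * (norm d)\<^sup>2"
    using Cauchy_Schwarz_ineq2[of "err r" d] young[of 3 "norm (err r)" "norm d"] by simp
  have y3: "- (\<mu>d \<bullet> d) \<le> 3 * \<Lambda>\<^sup>2 / 2 * (norm (dx r))\<^sup>2 + 1 / 6 * (norm d)\<^sup>2"
  proof -
    have "- (\<mu>d \<bullet> d) \<le> norm \<mu>d * norm d" using Cauchy_Schwarz_ineq2[of \<mu>d d] by linarith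
    also have "\<dots> \<le> (\<Lambda> * norm (dx r)) * norm d" using \<mu>d by (intro mult_right_mono) auto
    also have "\<dots> \<le> 3 / 2 * (\<Lambda> * norm (dx r))\<^sup>2 + (norm d)\<^sup>2 / 6"
      using young[of 3 "\<Lambda> * norm (dx r)" "norm d"] by simp
    finally show ?thesis by (simp add: power_mult_distrib)
  qed
  define c1 where "c1 = (1 - \<rho> * \<gamma>) * \<gamma> / 2 + \<gamma> - (1 - \<rho> * \<gamma>) / \<rho>"
  have c1: "(1 - \<rho> * \<gamma>) * (\<rho> - \<gamma> * \<rho>\<^sup>2 / 2) * (norm (m (Suc r)))\<^sup>2 - \<rho>\<^sup>2 * \<gamma> * (norm (m (Suc r)))\<^sup>2
      = - c1 * (norm (l (Suc (Suc r)) - l (Suc r)))\<^sup>2"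
    unfolding dl using pos by (simp add: c1_def power_mult_distrib power2_eq_square field_simps)
  have "(\<Lambda> - \<beta> / 2 + 3 * \<Lambda>\<^sup>2 / 2 + 5 / 6) * (norm d)\<^sup>2 \<le> (- 1 / 6) * (norm d)\<^sup>2"
    using primal_margin \<Lambda>_nonneg
    by (intro mult_right_mono) (auto simp: power2_eq_square algebra_simps)
  then have d: "\<Lambda> * (norm d)\<^sup>2 - \<beta> / 2 * (norm d)\<^sup>2 + 3 * \<Lambda>\<^sup>2 / 2 * (norm d)\<^sup>2 + 5 / 6 * (norm d)\<^sup>2
      \<le> - (1 / 6 * (norm d)\<^sup>2)"
    by (simp only: algebra_simps)
  define \<kappa> where "\<kappa> = (1 - \<rho> * \<gamma>) * \<rho> / 2"
  have dm: "\<kappa> * (norm (m (Suc r)))\<^sup>2 - \<kappa> * (norm (m r))\<^sup>2 + \<rho>\<^sup>2 * \<gamma> * (norm (m (Suc r)))\<^sup>2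
      \<le> (l (Suc (Suc r)) - l (Suc r)) \<bullet> q"
  proof -
    have "\<kappa> * (norm (m (Suc r)))\<^sup>2 - \<kappa> * (norm (m r))\<^sup>2
        = \<rho> * (1 - \<rho> * \<gamma>) / 2 * ((norm (m (Suc r)))\<^sup>2 - (norm (m r))\<^sup>2)"
      by (simp add: \<kappa>_def field_simps)
    then show ?thesis
      using dual_momentum[of r] unfolding d_def[symmetric] q_def[symmetric] by linarith
  qed
  note eqs = Q_eq[of "Suc r", folded d_def \<kappa>_def] Q_eq[of r, folded \<kappa>_def]
    P_change[of "Suc r", folded d_def, folded q_def]
  show ?thesis
    unfolding c1_def[symmetric] d_def[symmetric]
    using eqs dm v1 v3[unfolded right_diff_distrib] B[unfolded right_diff_distrib] \<phi> AB e gd y1 y2 y3 c1 d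
    by linarith
qed

end


section \<open>Merit function, initial potential and residual\<close>

context pda_params
begin

definition "gap_scale = 2 + kB\<^sup>2 + kA / \<beta> + 1 / \<beta>"
definition "gap_factor = 4 * gap_scale\<^sup>2 + 1 / \<beta>\<^sup>2 + 1 / \<rho>\<^sup>2"
definition "dual_rate = (1 - \<rho> * \<gamma>) * \<gamma> / 2 + \<gamma> - (1 - \<rho> * \<gamma>) / \<rho>"
definition "descent_rate = min dual_rate (1 / 6)"

lemma descent_rate_pos: "0 < descent_rate"
  using dual_margin by (simp add: descent_rate_def dual_rate_def)

lemma gap_scale_ge: "2 + kB\<^sup>2 \<le> gap_scale" "kA / \<beta> \<le> gap_scale" "1 / \<beta> \<le> gap_scale" "0 \<le> gap_scale"
proof -
  have "0 \<le> kB\<^sup>2" "0 \<le> kA / \<beta>" "0 \<le> 1 / \<beta>" using kA_nonneg pos by auto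
  then show "2 + kB\<^sup>2 \<le> gap_scale" "kA / \<beta> \<le> gap_scale" "1 / \<beta> \<le> gap_scale" "0 \<le> gap_scale"
    unfolding gap_scale_def by linarith+
qed

lemma gap_factor_pos: "0 < gap_factor"
proof -
  have "0 < 1 / \<beta>\<^sup>2" "0 \<le> 1 / \<rho>\<^sup>2" using pos by auto
  then show ?thesis unfolding gap_factor_def
    by (intro add_pos_nonneg add_nonneg_pos) auto
qed

end

context pda_path
begin

text \<open>The proximal point \<open>y\<close> and the next iterate satisfy variational inequalities for the same \<open>h\<close> and
\<open>X\<close>. Testing each at the other point cancels \<open>h\<close> and bounds their distance by the difference of the
two linear parts, which consists of steps, the error and the gradient bias \<open>t\<close>.\<close>

lemma gap_bound:
  assumes t: "norm (g\<phi> (x r) - gradf (x r)) \<le> t"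
  shows "optimality_gap A X gradf h \<rho> \<beta> (x r) (l r) (x (Suc r)) (l (Suc r))
    \<le> gap_factor * ((norm (dx r))\<^sup>2 + (norm (l (Suc r) - l r))\<^sup>2 + (norm (err r))\<^sup>2 + t\<^sup>2)"
proof -
  define dl where "dl = l (Suc r) - l r"
  define c where "c = x r - (1 / \<beta>) *\<^sub>R (gradf (x r) + transpose A *v l r)"
  define y where "y = prox \<beta> (\<lambda>z. ereal (h z) + indicator_fun X z) c"
  define w where "w = x (Suc r) - y"
  define bias where "bias = gradf (x r) - g\<phi> (x r)"
  have Xne: "X \<noteq> {}" using x_in by blast
  have yX: "y \<in> X" unfolding y_def
    by (rule prox_minimizes(1)[OF closed_X Xne convex_h h_nonneg pos(3)])
  have t0: "0 \<le> t" using norm_ge_zero t by (rule order_trans)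
  have bias: "norm bias \<le> t" using t by (simp add: bias_def norm_minus_commute)
  have "0 \<le> \<beta> * ((y - c) \<bullet> (x (Suc r) - y)) + (h (x (Suc r)) - h y)"
    unfolding y_def
    by (rule prox_variational_inequality[OF closed_X convex_X Xne convex_h h_nonneg pos(3) x_in])
  moreover have "\<beta> * ((y - c) \<bullet> (x (Suc r) - y))
      = \<beta> * (dx r \<bullet> w) - \<beta> * (norm w)\<^sup>2 + gradf (x r) \<bullet> w + l r \<bullet> (A *v w)"
  proof -
    have yc: "y - c = dx r - w + (1 / \<beta>) *\<^sub>R (gradf (x r) + transpose A *v l r)"
      by (simp add: c_def dx_def w_def)
    show ?thesis
      unfolding w_def[symmetric] yc power2_norm_eq_inner inner_add_left inner_diff_left
        inner_scaleR_left inner_transpose_mult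
      using pos by (simp add: field_simps)
  qed
  moreover have "0 \<le> - (g r \<bullet> w) - l (Suc r) \<bullet> (A *v w) - \<beta> * ((B *v dx r) \<bullet> (B *v w))
      + (h y - h (x (Suc r)))"
  proof -
    have e: "y - x (Suc r) = - w" by (simp add: w_def)
    have neg: "M *v (- w) = - (M *v w)" for M :: "real^'n^'m"
      using matrix_vector_mult_scaleR[of M "-1" w] by simp
    show ?thesis using variational_inequality[OF yX, of r] unfolding e neg by simp
  qed
  ultimately have "\<beta> * (norm w)\<^sup>2 \<le> \<beta> * (dx r \<bullet> w) - \<beta> * ((B *v dx r) \<bullet> (B *v w))
      - dl \<bullet> (A *v w) + (bias \<bullet> w - err r \<bullet> w)"
    by (simp add: dl_def bias_def err_def inner_diff_left)
  also have "\<dots> \<le> \<beta> * (norm (dx r) * norm w) + \<beta> * (kB\<^sup>2 * (norm (dx r) * norm w))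
      + kA * (norm dl * norm w) + (t * norm w + norm (err r) * norm w)"
  proof -
    have a1: "\<beta> * (dx r \<bullet> w) \<le> \<beta> * (norm (dx r) * norm w)"
      using pos by (intro mult_left_mono norm_cauchy_schwarz) auto
    have "- ((B *v dx r) \<bullet> (B *v w)) \<le> kB\<^sup>2 * (norm (dx r) * norm w)"
      using inner_B_le[of "dx r" w] by linarith
    then have "\<beta> * - ((B *v dx r) \<bullet> (B *v w)) \<le> \<beta> * (kB\<^sup>2 * (norm (dx r) * norm w))"
      using pos by (intro mult_left_mono) auto
    then have a2: "- (\<beta> * ((B *v dx r) \<bullet> (B *v w))) \<le> \<beta> * (kB\<^sup>2 * (norm (dx r) * norm w))" by simp
    have a3: "- (dl \<bullet> (A *v w)) \<le> kA * (norm dl * norm w)"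
      using inner_A_le[of dl w] by linarith
    have "bias \<bullet> w \<le> norm bias * norm w" by (rule norm_cauchy_schwarz)
    also have "\<dots> \<le> t * norm w" using bias by (intro mult_right_mono) auto
    finally have a4: "bias \<bullet> w \<le> t * norm w" .
    have a5: "- (err r \<bullet> w) \<le> norm (err r) * norm w"
      using Cauchy_Schwarz_ineq2[of "err r" w] by linarith
    show ?thesis using a1 a2 a3 a4 a5 by linarith
  qed
  also have "\<dots> = (\<beta> * ((1 + kB\<^sup>2) * norm (dx r) + kA / \<beta> * norm dl + 1 / \<beta> * (norm (err r) + t))) * norm w"
    using pos by (simp add: field_simps)
  finally have "norm w \<le> (1 + kB\<^sup>2) * norm (dx r) + kA / \<beta> * norm dl + 1 / \<beta> * (norm (err r) + t)"
    using pos t0 kA_nonneg by (cases "norm w = 0") (auto simp: power2_eq_square)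
  moreover have "norm (x r - y) \<le> norm (dx r) + norm w"
  proof -
    have "x r - y = w - dx r" by (simp add: dx_def w_def)
    then show ?thesis using norm_triangle_ineq4[of w "dx r"] by simp
  qed
  ultimately have "norm (x r - y) \<le> (2 + kB\<^sup>2) * norm (dx r) + kA / \<beta> * norm dl
      + 1 / \<beta> * norm (err r) + 1 / \<beta> * t"
    by (simp add: algebra_simps)
  also have "\<dots> \<le> gap_scale * norm (dx r) + gap_scale * norm dl + gap_scale * norm (err r) + gap_scale * t"
    using t0 by (intro add_mono mult_right_mono gap_scale_ge) auto
  also have "\<dots> = gap_scale * (norm (dx r) + norm dl + norm (err r) + t)"
    by (simp add: algebra_simps)
  finally have "(norm (x r - y))\<^sup>2 \<le> (gap_scale * (norm (dx r) + norm dl + norm (err r) + t))\<^sup>2"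
    by (intro power_mono) auto
  also have "\<dots> \<le> gap_scale\<^sup>2 * (4 * ((norm (dx r))\<^sup>2 + (norm dl)\<^sup>2 + (norm (err r))\<^sup>2 + t\<^sup>2))"
    unfolding power_mult_distrib by (intro mult_left_mono sum_sq_le4) auto
  finally have main: "(norm (x r - y))\<^sup>2
      \<le> 4 * gap_scale\<^sup>2 * ((norm (dx r))\<^sup>2 + (norm dl)\<^sup>2 + (norm (err r))\<^sup>2 + t\<^sup>2)"
    by (simp only: mult_ac)
  have e: "optimality_gap A X gradf h \<rho> \<beta> (x r) (l r) (x (Suc r)) (l (Suc r))
    = (norm (x r - y))\<^sup>2 + 1 / \<beta>\<^sup>2 * (norm (dx r))\<^sup>2 + 1 / \<rho>\<^sup>2 * (norm dl)\<^sup>2"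
    unfolding optimality_gap_def y_def c_def dx_def dl_def ..
  have "1 / \<beta>\<^sup>2 * (norm (dx r))\<^sup>2 \<le> 1 / \<beta>\<^sup>2 * ((norm (dx r))\<^sup>2 + (norm dl)\<^sup>2 + (norm (err r))\<^sup>2 + t\<^sup>2)"
    "1 / \<rho>\<^sup>2 * (norm dl)\<^sup>2 \<le> 1 / \<rho>\<^sup>2 * ((norm (dx r))\<^sup>2 + (norm dl)\<^sup>2 + (norm (err r))\<^sup>2 + t\<^sup>2)"
    by (intro mult_left_mono; simp)+
  with main show ?thesis
    unfolding e gap_factor_def dl_def[symmetric] distrib_right by linarith
qed

text \<open>By \<open>potential_value_identity\<close> the dual contributions amount to \<open>\<gamma> / 2\<close> times the squared dual iterate
and a cross term with the last dual step. Young's inequality moves the cross term into the step at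
the expense of a fraction \<open>\<epsilon>\<close> of the main term.\<close>

lemma potential_lower_bound:
  assumes \<epsilon>: "0 < \<epsilon>"
  shows "\<phi> (x (Suc r)) + (1 - \<epsilon>) * \<gamma> / 2 * (norm (l (Suc r)))\<^sup>2
    - 1 / (2 * \<epsilon> * \<gamma>) * (norm (m r))\<^sup>2 \<le> Q r"
proof -
  have "- ((1 - \<rho> * \<gamma>) * (l (Suc r) \<bullet> m r)) \<le> norm (l (Suc r)) * norm (m r)"
  proof -
    have "- ((1 - \<rho> * \<gamma>) * (l (Suc r) \<bullet> m r)) \<le> \<bar>(1 - \<rho> * \<gamma>) * (l (Suc r) \<bullet> m r)\<bar>" by linarith
    also have "\<dots> = (1 - \<rho> * \<gamma>) * \<bar>l (Suc r) \<bullet> m r\<bar>" using damping by (simp add: abs_mult)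
    also have "\<dots> \<le> 1 * \<bar>l (Suc r) \<bullet> m r\<bar>" using pos by (intro mult_right_mono) auto
    finally show ?thesis using Cauchy_Schwarz_ineq2[of "l (Suc r)" "m r"] by linarith
  qed
  also have "\<dots> \<le> \<epsilon> * \<gamma> / 2 * (norm (l (Suc r)))\<^sup>2 + (norm (m r))\<^sup>2 / (2 * (\<epsilon> * \<gamma>))"
    using \<epsilon> pos by (intro young) auto
  finally have y: "- ((1 - \<rho> * \<gamma>) * (l (Suc r) \<bullet> m r))
      \<le> \<epsilon> * \<gamma> / 2 * (norm (l (Suc r)))\<^sup>2 + 1 / (2 * \<epsilon> * \<gamma>) * (norm (m r))\<^sup>2"
    by (simp add: mult.assoc)
  have nn: "0 \<le> (1 - \<rho> * \<gamma>) * \<rho> / 2 * (norm (m r))\<^sup>2" "0 \<le> \<beta> / 2 * (norm (B *v dx r))\<^sup>2"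
    "0 \<le> 3 * \<Lambda>\<^sup>2 / 2 * (norm (dx r))\<^sup>2" "0 \<le> h (x (Suc r))"
    "0 \<le> \<rho> / 2 * (1 - \<rho> * \<gamma>)\<^sup>2 * (norm (m r))\<^sup>2"
    using damping pos h_nonneg[OF x_in] by auto
  have "P (Suc r) = \<phi> (x (Suc r)) + h (x (Suc r)) + (\<gamma> / 2 * (norm (l (Suc r)))\<^sup>2
      + (1 - \<rho> * \<gamma>) * (l (Suc r) \<bullet> m r) + \<rho> / 2 * (1 - \<rho> * \<gamma>)\<^sup>2 * (norm (m r))\<^sup>2)"
    using potential_value_identity[OF residual[of r] l_Suc[of r]] unfolding P_def by linarith
  moreover have "(1 - \<epsilon>) * \<gamma> / 2 * (norm (l (Suc r)))\<^sup>2
      = \<gamma> / 2 * (norm (l (Suc r)))\<^sup>2 - \<epsilon> * \<gamma> / 2 * (norm (l (Suc r)))\<^sup>2"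
    by (simp add: field_simps)
  ultimately show ?thesis
    using Q_eq[of r] nn y by linarith
qed

definition steps where "steps R = (\<Sum>r=1..R. (norm (dx r))\<^sup>2 + (norm (l (Suc r) - l r))\<^sup>2)"
definition errs where "errs R = (\<Sum>r\<le>R. (norm (err r))\<^sup>2)"

lemma summed_descent: "Q R \<le> Q 0 - descent_rate * steps R + 7 / 2 * errs R"
proof -
  have "Q R \<le> Q 0 - descent_rate * steps R + 2 * (\<Sum>r\<le>R. (norm (err r))\<^sup>2) + 3 / 2 * (\<Sum>r<R. (norm (err r))\<^sup>2)"
  proof (induction R)
    case 0
    then show ?case by (simp add: steps_def)
  next
    case (Suc R)
    have "descent_rate * (norm (l (Suc (Suc R)) - l (Suc R)))\<^sup>2 \<le> dual_rate * (norm (l (Suc (Suc R)) - l (Suc R)))\<^sup>2"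
      "descent_rate * (norm (dx (Suc R)))\<^sup>2 \<le> 1 / 6 * (norm (dx (Suc R)))\<^sup>2"
      unfolding descent_rate_def by (intro mult_right_mono; simp)+
    then have "Q (Suc R) \<le> Q R - descent_rate * ((norm (dx (Suc R)))\<^sup>2 + (norm (l (Suc (Suc R)) - l (Suc R)))\<^sup>2)
       + 2 * (norm (err (Suc R)))\<^sup>2 + 3 / 2 * (norm (err R))\<^sup>2"
      using potential_descent[of R] unfolding dual_rate_def[symmetric] distrib_left by linarith
    then show ?case
      using Suc.IH by (simp add: steps_def algebra_simps)
  qed
  also have "(\<Sum>r<R. (norm (err r))\<^sup>2) \<le> (\<Sum>r\<le>R. (norm (err r))\<^sup>2)"
    by (intro sum_mono2) auto
  finally show ?thesis by (simp add: errs_def)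
qed

lemma step_le_steps:
  assumes "1 \<le> r" "r \<le> R"
  shows "(norm (dx r))\<^sup>2 + (norm (l (Suc r) - l r))\<^sup>2 \<le> steps R"
  unfolding steps_def using assms
  by (intro member_le_sum[where f="\<lambda>r. (norm (dx r))\<^sup>2 + (norm (l (Suc r) - l r))\<^sup>2"]) auto

text \<open>Descent begins only after step \<open>0\<close>, so \<open>steps\<close> does not contain the initial dual step. It can be
recovered from step \<open>1\<close> by solving \<open>A_dx\<close> for \<open>m 0\<close>, which the damping \<open>\<rho> \<gamma> < 1\<close> permits.\<close>

lemma first_dual_step:
  assumes "1 \<le> R"
  shows "(norm (m 0))\<^sup>2 \<le> 2 * (kA\<^sup>2 + 1 / \<rho>\<^sup>2) / (1 - \<rho> * \<gamma>)\<^sup>2 * steps R"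
proof -
  have "(1 - \<rho> * \<gamma>) *\<^sub>R m 0 = m 1 - A *v dx 1" using A_dx[of 0] by simp
  then have "(1 - \<rho> * \<gamma>) * norm (m 0) = norm (m 1 - A *v dx 1)"
    using damping by (metis abs_of_pos diff_gt_0_iff_gt norm_scaleR)
  also have "\<dots> \<le> norm (m 1) + kA * norm (dx 1)"
    using norm_triangle_ineq4[of "m 1" "A *v dx 1"] kA[of "dx 1"] by linarith
  finally have "((1 - \<rho> * \<gamma>) * norm (m 0))\<^sup>2 \<le> (norm (m 1) + kA * norm (dx 1))\<^sup>2"
    using damping by (intro power_mono) auto
  also have "\<dots> \<le> 2 * ((norm (m 1))\<^sup>2 + (kA * norm (dx 1))\<^sup>2)" by (rule sum_sq_le2)
  also have "(norm (m 1))\<^sup>2 = 1 / \<rho>\<^sup>2 * (norm (l (Suc 1) - l 1))\<^sup>2"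
    using pos by (simp add: m_def power_mult_distrib power_divide)
  also have "2 * (1 / \<rho>\<^sup>2 * (norm (l (Suc 1) - l 1))\<^sup>2 + (kA * norm (dx 1))\<^sup>2)
      \<le> 2 * (kA\<^sup>2 + 1 / \<rho>\<^sup>2) * ((norm (dx 1))\<^sup>2 + (norm (l (Suc 1) - l 1))\<^sup>2)"
  proof -
    have "0 \<le> 1 / \<rho>\<^sup>2 * (norm (dx 1))\<^sup>2" "0 \<le> kA\<^sup>2 * (norm (l (Suc 1) - l 1))\<^sup>2" by auto
    then show ?thesis by (simp add: power_mult_distrib distrib_left distrib_right)
  qed
  also have "\<dots> \<le> 2 * (kA\<^sup>2 + 1 / \<rho>\<^sup>2) * steps R"
    using assms by (intro mult_left_mono step_le_steps) auto
  finally have "(1 - \<rho> * \<gamma>)\<^sup>2 * (norm (m 0))\<^sup>2 \<le> 2 * (kA\<^sup>2 + 1 / \<rho>\<^sup>2) * steps R"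
    by (simp add: power_mult_distrib)
  moreover have "0 < (1 - \<rho> * \<gamma>)\<^sup>2" using damping by simp
  ultimately show ?thesis by (simp add: field_simps)
qed

lemma dual_drift:
  assumes "r \<le> R"
  shows "(norm (l (Suc r) - l 1))\<^sup>2 \<le> real R * steps R"
proof -
  have "l (Suc r) - l 1 = (\<Sum>s=1..r. l (Suc s) - l s)"
    by (simp add: sum_Suc_diff)
  then have "norm (l (Suc r) - l 1) \<le> (\<Sum>s=1..r. norm (l (Suc s) - l s))"
    using norm_sum by metis
  then have "(norm (l (Suc r) - l 1))\<^sup>2 \<le> (\<Sum>s=1..r. norm (l (Suc s) - l s))\<^sup>2"
    by (intro power_mono) auto
  also have "\<dots> \<le> (\<Sum>s=1..r. (norm (l (Suc s) - l s))\<^sup>2) * real r"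
    using Cauchy_Schwarz_ineq_sum[of "\<lambda>s. norm (l (Suc s) - l s)" "\<lambda>_. 1" "{1..r}"] by simp
  also have "\<dots> \<le> steps R * real R"
  proof (intro mult_mono)
    have "(\<Sum>s=1..r. (norm (l (Suc s) - l s))\<^sup>2) \<le> (\<Sum>s=1..R. (norm (l (Suc s) - l s))\<^sup>2)"
      using assms by (intro sum_mono2) auto
    also have "\<dots> \<le> steps R" unfolding steps_def by (intro sum_mono) auto
    finally show "(\<Sum>s=1..r. (norm (l (Suc s) - l s))\<^sup>2) \<le> steps R" .
    show "0 \<le> steps R" unfolding steps_def by (intro sum_nonneg) auto
  qed (use assms in auto)
  finally show ?thesis by (simp add: mult.commute)
qed

lemma infeasibility_bound:
  assumes \<epsilon>: "0 < \<epsilon>" and r: "1 \<le> r" "r \<le> R"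
  shows "(norm (A *v x (Suc r) - b))\<^sup>2
    \<le> (1 + \<epsilon>) * (\<gamma>\<^sup>2 * (norm (l 1))\<^sup>2) + (1 + 1 / \<epsilon>) * (2 * (\<gamma>\<^sup>2 * real R + 1 / \<rho>\<^sup>2)) * steps R"
proof -
  have st0: "0 \<le> steps R" unfolding steps_def by (intro sum_nonneg) auto
  have e: "A *v x (Suc r) - b = \<gamma> *\<^sub>R l 1 + (\<gamma> *\<^sub>R (l r - l 1) + m r)"
    unfolding residual by (simp add: algebra_simps)
  obtain s where s: "r = Suc s" "s \<le> R" using r by (cases r) auto
  have "(norm (\<gamma> *\<^sub>R (l r - l 1) + m r))\<^sup>2 \<le> (norm (\<gamma> *\<^sub>R (l r - l 1)) + norm (m r))\<^sup>2"
    by (intro power_mono norm_triangle_ineq) auto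
  also have "\<dots> \<le> 2 * ((norm (\<gamma> *\<^sub>R (l r - l 1)))\<^sup>2 + (norm (m r))\<^sup>2)" by (rule sum_sq_le2)
  also have "\<dots> = 2 * (\<gamma>\<^sup>2 * (norm (l r - l 1))\<^sup>2 + 1 / \<rho>\<^sup>2 * (norm (l (Suc r) - l r))\<^sup>2)"
    using pos by (simp add: m_def power_mult_distrib power_divide)
  also have "\<dots> \<le> 2 * (\<gamma>\<^sup>2 * (real R * steps R) + 1 / \<rho>\<^sup>2 * steps R)"
    using dual_drift[OF s(2)] step_le_steps[OF r] unfolding s(1)[symmetric]
    by (intro mult_left_mono add_mono) (auto intro: order_trans[rotated])
  finally have "(norm (\<gamma> *\<^sub>R (l r - l 1) + m r))\<^sup>2 \<le> 2 * (\<gamma>\<^sup>2 * real R + 1 / \<rho>\<^sup>2) * steps R"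
    by (simp add: algebra_simps)
  then have "(1 + 1 / \<epsilon>) * (norm (\<gamma> *\<^sub>R (l r - l 1) + m r))\<^sup>2
      \<le> (1 + 1 / \<epsilon>) * (2 * (\<gamma>\<^sup>2 * real R + 1 / \<rho>\<^sup>2) * steps R)"
    using \<epsilon> by (intro mult_left_mono) auto
  moreover have "(norm (A *v x (Suc r) - b))\<^sup>2 \<le> (1 + \<epsilon>) * (norm (\<gamma> *\<^sub>R l 1))\<^sup>2
      + (1 + 1 / \<epsilon>) * (norm (\<gamma> *\<^sub>R (l r - l 1) + m r))\<^sup>2"
    unfolding e by (rule norm_add_sq_le[OF \<epsilon>])
  ultimately show ?thesis by (simp add: power_mult_distrib mult.assoc)
qed

end


section \<open>The estimate along a trajectory\<close>

context pda_params
begin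

definition "infeas_factor \<epsilon> \<nu> = (1 + 1 / \<epsilon>) * (2 * (\<gamma>\<^sup>2 * \<nu> + 1 / \<rho>\<^sup>2))"
definition "first_factor \<epsilon> = 1 / ((1 - \<rho> * \<gamma>) * \<epsilon> * \<gamma>) * (2 * (kA\<^sup>2 + 1 / \<rho>\<^sup>2) / (1 - \<rho> * \<gamma>)\<^sup>2)"
definition "step_factor \<epsilon> \<nu> = gap_factor + \<nu> * infeas_factor \<epsilon> \<nu> + first_factor \<epsilon>"

lemma step_factor_pos:
  assumes "0 < \<epsilon>" "0 \<le> \<nu>"
  shows "0 < step_factor \<epsilon> \<nu>"
proof -
  have "0 \<le> infeas_factor \<epsilon> \<nu>" "0 \<le> first_factor \<epsilon>"
    using assms pos damping by (auto simp: infeas_factor_def first_factor_def)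
  then show ?thesis using gap_factor_pos assms by (auto simp: step_factor_def intro!: add_pos_nonneg)
qed

end

context pda_path
begin

text \<open>The parameter \<open>\<nu>\<close> is any bound on \<open>R\<close> and keeps the factors free of \<open>R\<close>. The hypothesis \<open>slack\<close> is
the comparison of the coefficients of the squared first dual iterate: \<open>(1 + \<epsilon>) \<gamma>\<^sup>2\<close> from the \<open>R\<close>
residuals against \<open>(1 - \<epsilon>) \<gamma> / (1 - \<rho> \<gamma>)\<close> from twice the initial potential.\<close>

theorem pathwise_bound:
  assumes R: "1 \<le> R" "real R \<le> \<nu>" and \<epsilon>: "0 < \<epsilon>"
    and slack: "(1 + \<epsilon>) * (\<gamma> * real R * (1 - \<rho> * \<gamma>)) \<le> 1 - \<epsilon>"
    and bias: "\<And>y. norm (g\<phi> y - gradf y) \<le> t"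
    and low: "- \<tau> \<le> \<phi> (x 1)"
  shows "(\<Sum>r=1..R. optimality_gap A X gradf h \<rho> \<beta> (x r) (l r) (x (Suc r)) (l (Suc r))
        + (norm (A *v x (Suc r) - b))\<^sup>2)
    \<le> step_factor \<epsilon> \<nu> / descent_rate * (Q 0 - Q R) + 2 * Q 0 / (1 - \<rho> * \<gamma>)
      + (gap_factor + 7 / 2 * (step_factor \<epsilon> \<nu> / descent_rate)) * errs R
      + gap_factor * \<nu> * t\<^sup>2 + 2 * \<tau> / (1 - \<rho> * \<gamma>)"
proof -
  define S where "S = steps R"
  define E where "E = errs R"
  define L1 where "L1 = (norm (l 1))\<^sup>2"
  define gap where "gap r = optimality_gap A X gradf h \<rho> \<beta> (x r) (l r) (x (Suc r)) (l (Suc r))" for r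
  have S0: "0 \<le> S" unfolding S_def steps_def by (intro sum_nonneg) auto
  have L0: "0 \<le> L1" by (simp add: L1_def)
  have \<nu>0: "0 \<le> \<nu>" using R by simp
  have a0: "0 < 1 - \<rho> * \<gamma>" using damping by simp
  have gaps: "(\<Sum>r=1..R. gap r) \<le> gap_factor * (S + E + \<nu> * t\<^sup>2)"
  proof -
    have "(\<Sum>r=1..R. gap r) \<le> (\<Sum>r=1..R. gap_factor
        * (((norm (dx r))\<^sup>2 + (norm (l (Suc r) - l r))\<^sup>2) + (norm (err r))\<^sup>2 + t\<^sup>2))"
      unfolding gap_def by (intro sum_mono gap_bound bias)
    also have "\<dots> = gap_factor * (S + (\<Sum>r=1..R. (norm (err r))\<^sup>2) + real R * t\<^sup>2)"
      unfolding sum_distrib_left[symmetric] by (simp add: S_def steps_def sum.distrib)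
    also have "(\<Sum>r=1..R. (norm (err r))\<^sup>2) \<le> E"
      unfolding E_def errs_def by (intro sum_mono2) auto
    also have "real R * t\<^sup>2 \<le> \<nu> * t\<^sup>2" using R by (intro mult_right_mono) auto
    finally show ?thesis using gap_factor_pos by simp
  qed
  have inf: "(\<Sum>r=1..R. (norm (A *v x (Suc r) - b))\<^sup>2)
      \<le> real R * ((1 + \<epsilon>) * (\<gamma>\<^sup>2 * L1)) + \<nu> * infeas_factor \<epsilon> \<nu> * S"
  proof -
    have "(\<Sum>r=1..R. (norm (A *v x (Suc r) - b))\<^sup>2)
        \<le> (\<Sum>r=1..R. (1 + \<epsilon>) * (\<gamma>\<^sup>2 * L1) + infeas_factor \<epsilon> \<nu> * S)"
    proof (intro sum_mono)
      fix r assume r: "r \<in> {1..R}"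
      have "(1 + 1 / \<epsilon>) * (2 * (\<gamma>\<^sup>2 * real R + 1 / \<rho>\<^sup>2)) * S \<le> infeas_factor \<epsilon> \<nu> * S"
        unfolding infeas_factor_def using \<epsilon> S0 R
        by (intro mult_right_mono mult_left_mono add_mono) auto
      then show "(norm (A *v x (Suc r) - b))\<^sup>2 \<le> (1 + \<epsilon>) * (\<gamma>\<^sup>2 * L1) + infeas_factor \<epsilon> \<nu> * S"
        using infeasibility_bound[OF \<epsilon>, of r R] r unfolding S_def L1_def by auto
    qed
    also have "\<dots> = real R * ((1 + \<epsilon>) * (\<gamma>\<^sup>2 * L1)) + real R * (infeas_factor \<epsilon> \<nu> * S)"
      by (simp add: algebra_simps)
    also have "real R * (infeas_factor \<epsilon> \<nu> * S) \<le> \<nu> * (infeas_factor \<epsilon> \<nu> * S)"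
      using R S0 \<epsilon> \<nu>0 pos by (intro mult_right_mono) (auto simp: infeas_factor_def)
    finally show ?thesis by (simp add: mult.assoc)
  qed
  \<comment> \<open>The initial potential pays for the part of the residual that the first dual iterate contributes.\<close>
  have first: "real R * ((1 + \<epsilon>) * (\<gamma>\<^sup>2 * L1))
      \<le> 2 * Q 0 / (1 - \<rho> * \<gamma>) + 2 * \<tau> / (1 - \<rho> * \<gamma>) + first_factor \<epsilon> * S"
  proof -
    have "(1 + \<epsilon>) * (\<gamma> * real R * (1 - \<rho> * \<gamma>)) * (\<gamma> * L1) \<le> (1 - \<epsilon>) * (\<gamma> * L1)"
      using pos L0 by (intro mult_right_mono slack) auto
    then have "(1 - \<rho> * \<gamma>) * (real R * ((1 + \<epsilon>) * (\<gamma>\<^sup>2 * L1))) \<le> (1 - \<epsilon>) * (\<gamma> * L1)"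
      by (simp only: power2_eq_square mult_ac)
    also have "\<dots> = 2 * ((1 - \<epsilon>) * \<gamma> / 2 * L1)" by simp
    also have "\<dots> \<le> 2 * (Q 0 + \<tau> + 1 / (2 * \<epsilon> * \<gamma>) * (norm (m 0))\<^sup>2)"
      using potential_lower_bound[OF \<epsilon>, of 0] low by (simp add: L1_def)
    also have "\<dots> = 2 * Q 0 + 2 * \<tau> + 1 / (\<epsilon> * \<gamma>) * (norm (m 0))\<^sup>2"
      by (simp add: field_simps)
    also have "1 / (\<epsilon> * \<gamma>) * (norm (m 0))\<^sup>2
        \<le> 1 / (\<epsilon> * \<gamma>) * (2 * (kA\<^sup>2 + 1 / \<rho>\<^sup>2) / (1 - \<rho> * \<gamma>)\<^sup>2 * S)"
      unfolding S_def using \<epsilon> pos R by (intro mult_left_mono first_dual_step) auto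
    finally have le: "(1 - \<rho> * \<gamma>) * (real R * ((1 + \<epsilon>) * (\<gamma>\<^sup>2 * L1)))
      \<le> 2 * Q 0 + 2 * \<tau> + 1 / (\<epsilon> * \<gamma>) * (2 * (kA\<^sup>2 + 1 / \<rho>\<^sup>2) / (1 - \<rho> * \<gamma>)\<^sup>2 * S)" by simp
    have "real R * ((1 + \<epsilon>) * (\<gamma>\<^sup>2 * L1))
        \<le> (2 * Q 0 + 2 * \<tau> + 1 / (\<epsilon> * \<gamma>) * (2 * (kA\<^sup>2 + 1 / \<rho>\<^sup>2) / (1 - \<rho> * \<gamma>)\<^sup>2 * S)) / (1 - \<rho> * \<gamma>)"
      using le a0 by (simp add: pos_le_divide_eq mult.commute)
    also have "\<dots> = 2 * Q 0 / (1 - \<rho> * \<gamma>) + 2 * \<tau> / (1 - \<rho> * \<gamma>) + first_factor \<epsilon> * S"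
    proof -
      have "1 / (\<epsilon> * \<gamma>) * (c * S) / d = 1 / (d * \<epsilon> * \<gamma>) * c * S" for c d :: real
        by (simp add: mult_ac)
      then show ?thesis unfolding first_factor_def add_divide_distrib by (simp only: mult.assoc)
    qed
    finally show ?thesis .
  qed
  have St: "step_factor \<epsilon> \<nu> * S \<le> step_factor \<epsilon> \<nu> / descent_rate * (Q 0 - Q R + 7 / 2 * E)"
  proof -
    have "descent_rate * S \<le> Q 0 - Q R + 7 / 2 * E"
      using summed_descent[of R] unfolding S_def E_def by linarith
    then have "S \<le> (Q 0 - Q R + 7 / 2 * E) / descent_rate"
      using descent_rate_pos by (simp add: pos_le_divide_eq mult.commute)
    then have "step_factor \<epsilon> \<nu> * S \<le> step_factor \<epsilon> \<nu> * ((Q 0 - Q R + 7 / 2 * E) / descent_rate)"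
      using step_factor_pos[OF \<epsilon> \<nu>0] by (intro mult_left_mono) auto
    then show ?thesis by simp
  qed
  have "(\<Sum>r=1..R. gap r + (norm (A *v x (Suc r) - b))\<^sup>2)
      \<le> gap_factor * (S + E + \<nu> * t\<^sup>2) + (2 * Q 0 / (1 - \<rho> * \<gamma>) + 2 * \<tau> / (1 - \<rho> * \<gamma>) + first_factor \<epsilon> * S
        + \<nu> * infeas_factor \<epsilon> \<nu> * S)"
    unfolding sum.distrib using gaps inf first by linarith
  also have "\<dots> = step_factor \<epsilon> \<nu> * S + 2 * Q 0 / (1 - \<rho> * \<gamma>) + gap_factor * E
      + gap_factor * \<nu> * t\<^sup>2 + 2 * \<tau> / (1 - \<rho> * \<gamma>)"
    unfolding step_factor_def by (simp add: distrib_left distrib_right)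
  also have "\<dots> \<le> step_factor \<epsilon> \<nu> / descent_rate * (Q 0 - Q R + 7 / 2 * E) + 2 * Q 0 / (1 - \<rho> * \<gamma>)
      + gap_factor * E + gap_factor * \<nu> * t\<^sup>2 + 2 * \<tau> / (1 - \<rho> * \<gamma>)"
    using St by linarith
  finally show ?thesis unfolding gap_def E_def by (simp only: distrib_left distrib_right mult.assoc mult.left_commute)
qed

end

text \<open>Only finitely many \<open>R\<close> satisfy \<open>R c < 1\<close>, so the largest value of \<open>R c\<close> stays away from \<open>1\<close>.
Applied to \<open>c = \<gamma> (1 - \<rho> \<gamma>)\<close>, this provides one \<open>\<epsilon>\<close> for all admissible numbers of iterations.\<close>

lemma discrete_slack:
  fixes c :: real
  assumes "0 < c"
  shows "\<exists>\<epsilon>>0. \<forall>R::nat. real R * c < 1 \<longrightarrow> (1 + \<epsilon>) * (real R * c) \<le> 1 - \<epsilon>"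
proof -
  define S where "S = {R::nat. real R * c < 1}"
  have sub: "S \<subseteq> {..nat \<lceil>1 / c\<rceil>}"
  proof
    fix R assume "R \<in> S"
    then have "real R \<le> 1 / c" using assms by (simp add: S_def field_simps)
    also have "\<dots> \<le> real (nat \<lceil>1 / c\<rceil>)" by (rule real_nat_ceiling_ge)
    finally show "R \<in> {..nat \<lceil>1 / c\<rceil>}" by simp
  qed
  then have fin: "finite S" by (rule finite_subset) simp
  have ne: "S \<noteq> {}" by (auto simp: S_def intro!: exI[of _ 0])
  define n where "n = Max S"
  have "n \<in> S" unfolding n_def using fin ne by (rule Max_in)
  then have n: "real n * c < 1" by (simp add: S_def)
  define \<epsilon> where "\<epsilon> = (1 - real n * c) / 2"
  have \<epsilon>: "0 < \<epsilon>" using n by (simp add: \<epsilon>_def)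
  have "(1 + \<epsilon>) * (real R * c) \<le> 1 - \<epsilon>" if "real R * c < 1" for R :: nat
  proof -
    have "R \<le> n" unfolding n_def using fin that by (intro Max_ge) (auto simp: S_def)
    then have "real R * c \<le> real n * c" using assms by (intro mult_right_mono) auto
    then have "(1 + \<epsilon>) * (real R * c) \<le> (1 + \<epsilon>) * (real n * c)"
      using \<epsilon> by (intro mult_left_mono) auto
    also have "\<dots> \<le> real n * c + \<epsilon> * 1"
      using n \<epsilon> by (simp add: algebra_simps mult_left_le)
    also have "\<dots> = 1 - \<epsilon>" by (simp add: \<epsilon>_def field_simps)
    finally show ?thesis .
  qed
  then show ?thesis using \<epsilon> by blast
qed


section \<open>Random index and conditional second moments\<close>

lemma nn_integral_le_of_cond_exp_le:
  assumes "prob_space M" and sub: "subalgebra M F" and f[measurable]: "f \<in> borel_measurable M"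
    and bound: "AE \<omega> in M. nn_cond_exp M F f \<omega> \<le> c"
  shows "(\<integral>\<^sup>+\<omega>. f \<omega> \<partial>M) \<le> c"
proof -
  interpret prob_space M by fact
  interpret finite_measure_subalgebra M F by unfold_locales (rule sub)
  have "(\<integral>\<^sup>+\<omega>. f \<omega> \<partial>M) = (\<integral>\<^sup>+\<omega>. nn_cond_exp M F f \<omega> \<partial>M)"
    using nn_cond_exp_intg[of "\<lambda>_. 1" f] by simp
  also have "\<dots> \<le> (\<integral>\<^sup>+\<omega>. c \<partial>M)" by (intro nn_integral_mono_AE bound)
  also have "\<dots> = c" by (simp add: emeasure_space_1)
  finally show ?thesis .
qed

lemma sampling_measurable:
  assumes "sampling \<Omega> D J v \<xi>" "j \<in> {1..J}"
  shows "(\<lambda>\<omega>. (v r j \<omega>, \<xi> r j \<omega>)) \<in> measurable \<Omega> (borel \<Otimes>\<^sub>M D)"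
proof -
  interpret prob_space \<Omega> using assms(1) by (simp add: sampling_def)
  have "indep_vars (\<lambda>_. borel \<Otimes>\<^sub>M D) (\<lambda>(r, j) \<omega>. (v r j \<omega>, \<xi> r j \<omega>)) (UNIV \<times> {1..J})"
    using assms(1) by (simp add: sampling_def)
  then have "random_variable (borel \<Otimes>\<^sub>M D) ((\<lambda>(r, j) \<omega>. (v r j \<omega>, \<xi> r j \<omega>)) (r, j))"
    using assms(2) unfolding indep_vars_def2 by blast
  then show ?thesis by simp
qed

text \<open>Outside sub-\<open>\<sigma>\<close>-algebras \<open>nn_cond_exp\<close> is \<open>0\<close> by convention, so this is what gives content to the
assumed bound on the conditional second moment.\<close>

lemma past_subalgebra:
  fixes v :: "nat \<Rightarrow> nat \<Rightarrow> 'w \<Rightarrow> real^'n"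
  assumes s: "sampling \<Omega> D J v \<xi>"
  shows "subalgebra \<Omega> (past \<Omega> D J v \<xi> r)"
  unfolding subalgebra_def past_def
proof (intro conjI)
  define I where "I = {..<r} \<times> {1..J}"
  define Z where "Z = (\<lambda>\<omega>. \<lambda>(s, j)\<in>I. (v s j \<omega>, \<xi> s j \<omega>))"
  define N where "N = PiM I (\<lambda>_. (borel :: (real^'n) measure) \<Otimes>\<^sub>M D)"
  have Z: "Z \<in> measurable \<Omega> N"
    unfolding N_def Z_def
    by (rule measurable_restrict) (use sampling_measurable[OF s] in \<open>auto simp: I_def\<close>)
  have "sets (vimage_algebra (space \<Omega>) Z N) \<subseteq> sets \<Omega>"
    using Z by (subst sets_vimage_algebra2) (auto dest: measurable_space intro: measurable_sets)
  then show "sets (vimage_algebra (space \<Omega>) (\<lambda>\<omega>. \<lambda>(s, j)\<in>{..<r} \<times> {1..J}. (v s j \<omega>, \<xi> s j \<omega>))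
       (PiM ({..<r} \<times> {1..J}) (\<lambda>_. borel \<Otimes>\<^sub>M D))) \<subseteq> sets \<Omega>"
    by (simp add: Z_def N_def I_def)
qed simp

text \<open>Splitting according to the value of \<open>a\<close>, each summand is a product of two independent real random
variables, an indicator of \<open>a\<close> and a function of \<open>Z\<close>.\<close>

lemma expectation_at_uniform_index:
  fixes \<Phi> :: "nat \<Rightarrow> 'b \<Rightarrow> real" and \<Omega> :: "'a measure"
  assumes "prob_space \<Omega>"
    and law: "distr \<Omega> (count_space UNIV) a = measure_pmf (pmf_of_set {1..R})" and R: "1 \<le> R"
    and ind: "independent_rvs \<Omega> (count_space UNIV) a T Z"
    and meas: "\<And>r. \<Phi> r \<in> borel_measurable T"
    and int: "\<And>r. r \<in> {1..R} \<Longrightarrow> integrable \<Omega> (\<lambda>\<omega>. \<Phi> r (Z \<omega>))"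
  shows "(\<integral>\<omega>. \<Phi> (a \<omega>) (Z \<omega>) \<partial>\<Omega>) = (\<Sum>r=1..R. \<integral>\<omega>. \<Phi> r (Z \<omega>) \<partial>\<Omega>) / real R"
proof -
  interpret prob_space \<Omega> by fact
  have a[measurable]: "a \<in> measurable \<Omega> (count_space UNIV)" and Z[measurable]: "Z \<in> measurable \<Omega> T"
    and indep: "indep_set {a -` U \<inter> space \<Omega> | U. U \<in> sets (count_space UNIV)}
      {Z -` U \<inter> space \<Omega> | U. U \<in> sets T}"
    using ind by (auto simp: independent_rvs_def)
  note meas[measurable]
  have ne: "{1..R} \<noteq> {}" using R by simp
  have AE: "AE \<omega> in \<Omega>. a \<omega> \<in> {1..R}"
  proof -
    have "AE r in distr \<Omega> (count_space UNIV) a. r \<in> {1..R}"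
      unfolding law using ne by (auto simp: AE_measure_pmf_iff)
    then show ?thesis by (subst (asm) AE_distr_iff) auto
  qed
  have summand: "integrable \<Omega> (\<lambda>\<omega>. indicator {r} (a \<omega>) * \<Phi> r (Z \<omega>))"
    "(\<integral>\<omega>. indicator {r} (a \<omega>) * \<Phi> r (Z \<omega>) \<partial>\<Omega>) = (\<integral>\<omega>. \<Phi> r (Z \<omega>) \<partial>\<Omega>) / real R"
    if r: "r \<in> {1..R}" for r
  proof -
    define i :: "nat \<Rightarrow> real" where "i = indicator {r}"
    have [measurable]: "i \<in> borel_measurable (count_space UNIV)" by simp
    have ia: "(\<lambda>\<omega>. i (a \<omega>)) \<in> borel_measurable \<Omega>" and \<Phi>Z: "(\<lambda>\<omega>. \<Phi> r (Z \<omega>)) \<in> borel_measurable \<Omega>"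
      by measurable
    have iv: "indep_var borel (\<lambda>\<omega>. i (a \<omega>)) borel (\<lambda>\<omega>. \<Phi> r (Z \<omega>))"
      unfolding indep_var_eq
    proof (intro conjI indep_set_sigma_sets indep_setI)
      fix E1 E2
      assume "E1 \<in> {(\<lambda>\<omega>. i (a \<omega>)) -` U \<inter> space \<Omega> |U. U \<in> sets borel}"
        "E2 \<in> {(\<lambda>\<omega>. \<Phi> r (Z \<omega>)) -` U \<inter> space \<Omega> |U. U \<in> sets borel}"
      then obtain U1 U2 where U: "U2 \<in> sets borel" "E1 = (\<lambda>\<omega>. i (a \<omega>)) -` U1 \<inter> space \<Omega>"
        "E2 = (\<lambda>\<omega>. \<Phi> r (Z \<omega>)) -` U2 \<inter> space \<Omega>" by blast
      have "E1 = a -` (i -` U1) \<inter> space \<Omega>" using U by auto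
      then have E1: "E1 \<in> {a -` U \<inter> space \<Omega> |U. U \<in> sets (count_space UNIV)}" by auto
      have "E2 = Z -` (\<Phi> r -` U2 \<inter> space T) \<inter> space \<Omega>"
        using U measurable_space[OF Z] by auto
      moreover have "\<Phi> r -` U2 \<inter> space T \<in> sets T" using U(1) by measurable
      ultimately have "E2 \<in> {Z -` U \<inter> space \<Omega> |U. U \<in> sets T}" by blast
      with E1 show "prob (E1 \<inter> E2) = prob E1 * prob E2" by (rule indep_setD[OF indep])
    next
      have stable: "Int_stable {f -` U \<inter> space \<Omega> |U. U \<in> sets borel}" for f :: "'a \<Rightarrow> real"
      proof (rule Int_stableI)
        fix P Q assume "P \<in> {f -` U \<inter> space \<Omega> |U. U \<in> sets borel}" "Q \<in> {f -` U \<inter> space \<Omega> |U. U \<in> sets borel}"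
        then obtain U V where "U \<in> sets borel" "V \<in> sets borel" "P = f -` U \<inter> space \<Omega>" "Q = f -` V \<inter> space \<Omega>"
          by blast
        then show "P \<inter> Q \<in> {f -` U \<inter> space \<Omega> |U. U \<in> sets borel}"
          by (intro CollectI exI[of _ "U \<inter> V"]) auto
      qed
      show "Int_stable {(\<lambda>\<omega>. i (a \<omega>)) -` U \<inter> space \<Omega> |U. U \<in> sets borel}"
        "Int_stable {(\<lambda>\<omega>. \<Phi> r (Z \<omega>)) -` U \<inter> space \<Omega> |U. U \<in> sets borel}"
        by (rule stable)+
    qed (use ia \<Phi>Z in \<open>auto intro: measurable_sets\<close>)
    have "integrable \<Omega> (\<lambda>\<omega>. i (a \<omega>))"
      by (rule integrable_const_bound[where B=1]) (auto simp: i_def indicator_def)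
    note * = indep_var_integrable[OF iv this int[OF r]] indep_var_lebesgue_integral[OF iv this int[OF r]]
    show "integrable \<Omega> (\<lambda>\<omega>. indicator {r} (a \<omega>) * \<Phi> r (Z \<omega>))" using *(1) by (simp add: i_def)
    have "(\<integral>\<omega>. i (a \<omega>) \<partial>\<Omega>) = (\<integral>s. i s \<partial>distr \<Omega> (count_space UNIV) a)"
      by (subst integral_distr) auto
    also have "\<dots> = measure (measure_pmf (pmf_of_set {1..R})) {r}"
      unfolding law by (simp add: i_def)
    also have "\<dots> = 1 / real R" using r ne by (simp add: measure_pmf_single)
    finally show "(\<integral>\<omega>. indicator {r} (a \<omega>) * \<Phi> r (Z \<omega>) \<partial>\<Omega>) = (\<integral>\<omega>. \<Phi> r (Z \<omega>) \<partial>\<Omega>) / real R"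
      using *(2) by (simp add: i_def)
  qed
  have "(\<integral>\<omega>. \<Phi> (a \<omega>) (Z \<omega>) \<partial>\<Omega>) = (\<integral>\<omega>. (\<Sum>r=1..R. indicator {r} (a \<omega>) * \<Phi> r (Z \<omega>)) \<partial>\<Omega>)"
  proof (rule integral_cong_AE)
    have "(\<lambda>\<omega>. case (a \<omega>, Z \<omega>) of (n, z) \<Rightarrow> \<Phi> n z) \<in> borel_measurable \<Omega>"
      by (rule measurable_compose[OF measurable_Pair[OF a Z] measurable_pair_measure_countable1[of UNIV]]) auto
    then show "(\<lambda>\<omega>. \<Phi> (a \<omega>) (Z \<omega>)) \<in> borel_measurable \<Omega>" by simp
    show "AE \<omega> in \<Omega>. \<Phi> (a \<omega>) (Z \<omega>) = (\<Sum>r=1..R. indicator {r} (a \<omega>) * \<Phi> r (Z \<omega>))"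
      using AE
    proof eventually_elim
      case (elim \<omega>)
      have "(\<Sum>r=1..R. indicator {r} (a \<omega>) * \<Phi> r (Z \<omega>)) = (\<Sum>r\<in>{a \<omega>}. \<Phi> r (Z \<omega>))"
        using elim by (intro sum.mono_neutral_cong_right) (auto simp: indicator_def)
      then show ?case by simp
    qed
    have [measurable]: "(indicator {r} :: nat \<Rightarrow> real) \<in> borel_measurable (count_space UNIV)" for r by simp
    show "(\<lambda>\<omega>. \<Sum>r=1..R. indicator {r} (a \<omega>) * \<Phi> r (Z \<omega>)) \<in> borel_measurable \<Omega>"
      by measurable
  qed
  also have "\<dots> = (\<Sum>r=1..R. \<integral>\<omega>. indicator {r} (a \<omega>) * \<Phi> r (Z \<omega>) \<partial>\<Omega>)"
    by (intro Bochner_Integration.integral_sum summand) auto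
  also have "\<dots> = (\<Sum>r=1..R. (\<integral>\<omega>. \<Phi> r (Z \<omega>) \<partial>\<Omega>) / real R)"
    by (intro sum.cong refl summand)
  finally show ?thesis by (simp add: sum_divide_distrib)
qed

section \<open>Square-integrable random vectors\<close>

definition square_integrable :: "'w measure \<Rightarrow> ('w \<Rightarrow> 'a::euclidean_space) \<Rightarrow> bool" where
  "square_integrable M u \<longleftrightarrow> u \<in> borel_measurable M \<and> integrable M (\<lambda>\<omega>. (norm (u \<omega>))\<^sup>2)"

lemma square_integrable_add:
  assumes "square_integrable M u" "square_integrable M v"
  shows "square_integrable M (\<lambda>\<omega>. u \<omega> + v \<omega>)"
proof -
  have [measurable]: "u \<in> borel_measurable M" "v \<in> borel_measurable M"
    using assms by (auto simp: square_integrable_def)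
  have "integrable M (\<lambda>\<omega>. (norm (u \<omega> + v \<omega>))\<^sup>2)"
  proof (rule Bochner_Integration.integrable_bound)
    show "integrable M (\<lambda>\<omega>. 2 * ((norm (u \<omega>))\<^sup>2 + (norm (v \<omega>))\<^sup>2))"
      using assms by (auto simp: square_integrable_def)
    have "norm ((norm (u \<omega> + v \<omega>))\<^sup>2) \<le> norm (2 * ((norm (u \<omega>))\<^sup>2 + (norm (v \<omega>))\<^sup>2))" for \<omega>
    proof -
      have "(norm (u \<omega> + v \<omega>))\<^sup>2 \<le> (norm (u \<omega>) + norm (v \<omega>))\<^sup>2"
        by (intro power_mono norm_triangle_ineq) auto
      also note sum_sq_le2
      finally show ?thesis by simp
    qed
    then show "AE \<omega> in M. norm ((norm (u \<omega> + v \<omega>))\<^sup>2) \<le> norm (2 * ((norm (u \<omega>))\<^sup>2 + (norm (v \<omega>))\<^sup>2))"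
      by simp
  qed measurable
  then show ?thesis by (simp add: square_integrable_def)
qed

lemma square_integrable_bounded_linear:
  assumes "square_integrable M u" and T: "bounded_linear T"
  shows "square_integrable M (\<lambda>\<omega>. T (u \<omega>))"
proof -
  have [measurable]: "u \<in> borel_measurable M" using assms by (auto simp: square_integrable_def)
  have [measurable]: "T \<in> borel_measurable borel"
    by (intro borel_measurable_continuous_onI linear_continuous_on T)
  have "integrable M (\<lambda>\<omega>. (norm (T (u \<omega>)))\<^sup>2)"
  proof (rule Bochner_Integration.integrable_bound)
    show "integrable M (\<lambda>\<omega>. (onorm T)\<^sup>2 * (norm (u \<omega>))\<^sup>2)"
      using assms by (auto simp: square_integrable_def)
    have "norm ((norm (T (u \<omega>)))\<^sup>2) \<le> norm ((onorm T)\<^sup>2 * (norm (u \<omega>))\<^sup>2)" for \<omega>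
      using power_mono[OF onorm[OF T, of "u \<omega>"], of 2] by (simp add: power_mult_distrib abs_mult)
    then show "AE \<omega> in M. norm ((norm (T (u \<omega>)))\<^sup>2) \<le> norm ((onorm T)\<^sup>2 * (norm (u \<omega>))\<^sup>2)" by simp
  qed measurable
  then show ?thesis by (simp add: square_integrable_def)
qed

lemma square_integrable_scaleR: "square_integrable M u \<Longrightarrow> square_integrable M (\<lambda>\<omega>. c *\<^sub>R u \<omega>)"
  by (rule square_integrable_bounded_linear[where T="\<lambda>v. c *\<^sub>R v"]) (auto intro: bounded_linear_scaleR_right)

lemma square_integrable_diff:
  "square_integrable M u \<Longrightarrow> square_integrable M v \<Longrightarrow> square_integrable M (\<lambda>\<omega>. u \<omega> - v \<omega>)"
  using square_integrable_add[of M u "\<lambda>\<omega>. (- 1) *\<^sub>R v \<omega>"] square_integrable_scaleR[of M v "-1"] by simp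

lemma square_integrable_mult:
  "square_integrable M u \<Longrightarrow> square_integrable M (\<lambda>\<omega>. (M' :: real^'n^'m) *v u \<omega>)"
  by (rule square_integrable_bounded_linear) auto

lemma (in finite_measure) square_integrable_const: "square_integrable M (\<lambda>_. c)"
  by (simp add: square_integrable_def)

lemma integrable_inner:
  assumes "square_integrable M u" "square_integrable M v"
  shows "integrable M (\<lambda>\<omega>. u \<omega> \<bullet> v \<omega>)"
proof (rule Bochner_Integration.integrable_bound)
  show "integrable M (\<lambda>\<omega>. (norm (u \<omega>))\<^sup>2 + (norm (v \<omega>))\<^sup>2)"
    using assms by (auto simp: square_integrable_def)
  have [measurable]: "u \<in> borel_measurable M" "v \<in> borel_measurable M"
    using assms by (auto simp: square_integrable_def)
  show "(\<lambda>\<omega>. u \<omega> \<bullet> v \<omega>) \<in> borel_measurable M" by measurable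
  have "norm (u \<omega> \<bullet> v \<omega>) \<le> norm ((norm (u \<omega>))\<^sup>2 + (norm (v \<omega>))\<^sup>2)" for \<omega>
  proof -
    have "\<bar>u \<omega> \<bullet> v \<omega>\<bar> \<le> norm (u \<omega>) * norm (v \<omega>)" by (rule Cauchy_Schwarz_ineq2)
    also have "\<dots> \<le> 1 / 2 * (norm (u \<omega>))\<^sup>2 + (norm (v \<omega>))\<^sup>2 / (2 * 1)" by (rule young) simp
    also have "\<dots> \<le> (norm (u \<omega>))\<^sup>2 + (norm (v \<omega>))\<^sup>2"
      using zero_le_power2[of "norm (u \<omega>)"] zero_le_power2[of "norm (v \<omega>)"] by linarith
    finally show ?thesis by simp
  qed
  then show "AE \<omega> in M. norm (u \<omega> \<bullet> v \<omega>) \<le> norm ((norm (u \<omega>))\<^sup>2 + (norm (v \<omega>))\<^sup>2)" by simp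
qed


section \<open>The estimate in expectation\<close>

context pda_problem
begin

lemma gap_measurable:
  assumes X: "X \<noteq> {}" and gradf: "continuous_on UNIV gradf"
    and [measurable]: "u \<in> borel_measurable M" "p \<in> borel_measurable M"
      "u' \<in> borel_measurable M" "p' \<in> borel_measurable M"
  shows "(\<lambda>\<omega>. optimality_gap A X gradf h \<rho> \<beta> (u \<omega>) (p \<omega>) (u' \<omega>) (p' \<omega>)) \<in> borel_measurable M"
proof -
  define J where "J = prox \<beta> (\<lambda>z. ereal (h z) + indicator_fun X z)"
  have "1-lipschitz_on UNIV J"
    using prox_nonexpansive[OF closed_X convex_X X convex_h h_nonneg pos(3)]
    by (auto intro!: lipschitz_onI simp: J_def dist_norm)
  then have [measurable]: "J \<in> borel_measurable borel"
    by (intro borel_measurable_continuous_onI lipschitz_on_continuous_on)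
  have [measurable]: "gradf \<in> borel_measurable borel"
    by (intro borel_measurable_continuous_onI gradf)
  define T where "T = (*v) (transpose A)"
  have [measurable]: "T \<in> borel_measurable borel"
    unfolding T_def by (intro borel_measurable_continuous_onI linear_continuous_on matrix_vector_mul_bounded_linear)
  show ?thesis
    unfolding optimality_gap_def J_def[symmetric] T_def[symmetric] by measurable
qed

lemma gap_nonneg: "0 \<le> optimality_gap A X gradf h \<rho> \<beta> u p u' p'"
  by (simp add: optimality_gap_def)

lemma h_measurable: "h \<in> borel_measurable borel"
  by (intro borel_measurable_continuous_onI convex_on_continuous open_UNIV convex_h)

lemma \<phi>_measurable: "\<phi> \<in> borel_measurable borel"
  using grad by (intro borel_measurable_continuous_onI continuous_at_imp_continuous_on ballI has_derivative_continuous)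
    (auto simp: gderiv_def)

end

locale random_pda = pda_problem A B \<rho> \<gamma> \<beta> \<Lambda> b X h \<phi> g\<phi> + prob_space \<Omega>
  for A B :: "real^'n^'m" and \<rho> \<gamma> \<beta> \<Lambda> :: real and b :: "real^'m" and X :: "(real^'n) set"
    and h \<phi> :: "real^'n \<Rightarrow> real" and g\<phi> :: "real^'n \<Rightarrow> real^'n" and \<Omega> :: "'w measure" +
  fixes G x :: "nat \<Rightarrow> 'w \<Rightarrow> real^'n" and l :: "nat \<Rightarrow> 'w \<Rightarrow> real^'m" and x0 :: "real^'n" and l0 :: "real^'m"
  assumes path: "\<And>\<omega>. \<omega> \<in> space \<Omega> \<Longrightarrow>
      pda_path A B \<rho> \<gamma> \<beta> \<Lambda> b X h \<phi> g\<phi> (\<lambda>r. G r \<omega>) (\<lambda>r. x r \<omega>) (\<lambda>r. l r \<omega>)"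
    and start: "\<And>\<omega>. \<omega> \<in> space \<Omega> \<Longrightarrow> x 0 \<omega> = x0" "\<And>\<omega>. \<omega> \<in> space \<Omega> \<Longrightarrow> l 0 \<omega> = l0"
    and x_measurable[measurable]: "\<And>r. x r \<in> borel_measurable \<Omega>"
    and l_measurable[measurable]: "\<And>r. l r \<in> borel_measurable \<Omega>"
    and err_square_integrable: "\<And>r. square_integrable \<Omega> (\<lambda>\<omega>. G r \<omega> - g\<phi> (x r \<omega>))"
begin

lemma X_nonempty: "X \<noteq> {}"
  using not_empty pda_path.x_in[OF path] by blast

lemma x_in: "\<omega> \<in> space \<Omega> \<Longrightarrow> x (Suc r) \<omega> \<in> X"
  using pda_path.x_in[OF path] by blast

text \<open>Integrability of \<open>h\<close> along the iterates comes out of the same estimate as that of the squared norm: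
no growth condition on \<open>h\<close> is available, only the optimality of the step.\<close>

lemma next_primal_integrable:
  assumes x: "square_integrable \<Omega> (x r)" and l: "square_integrable \<Omega> (l r)"
  shows "square_integrable \<Omega> (x (Suc r))" "integrable \<Omega> (\<lambda>\<omega>. h (x (Suc r) \<omega>))"
proof -
  note h_measurable[measurable]
  obtain z where z: "z \<in> X" using X_nonempty by blast
  obtain k where k: "0 \<le> k" "\<And>g xr lr x'. is_arg_min (pda_objective A B b h \<rho> \<gamma> \<beta> g xr lr) (\<lambda>z. z \<in> X) x' \<Longrightarrow>
    (norm (x' - z))\<^sup>2 + h x' \<le> k * (1 + (norm (xr - z))\<^sup>2 + (norm lr)\<^sup>2 + (norm (g - g\<phi> xr))\<^sup>2)"
    using step_bounded[OF z] by blast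
  define W where "W \<omega> = k * (1 + (norm (x r \<omega> - z))\<^sup>2 + (norm (l r \<omega>))\<^sup>2 + (norm (G r \<omega> - g\<phi> (x r \<omega>)))\<^sup>2)" for \<omega>
  have "square_integrable \<Omega> (\<lambda>\<omega>. x r \<omega> - z)"
    by (intro square_integrable_diff x square_integrable_const)
  then have W: "integrable \<Omega> W"
    using l err_square_integrable[of r] unfolding W_def square_integrable_def by auto
  have le: "(norm (x (Suc r) \<omega> - z))\<^sup>2 + h (x (Suc r) \<omega>) \<le> W \<omega>" "0 \<le> h (x (Suc r) \<omega>)"
    if "\<omega> \<in> space \<Omega>" for \<omega>
    unfolding W_def using k(2)[OF pda_path.step[OF path[OF that]]] h_nonneg[OF x_in[OF that]] by auto
  have le1: "norm ((norm (x (Suc r) \<omega> - z))\<^sup>2) \<le> norm (W \<omega>)" if "\<omega> \<in> space \<Omega>" for \<omega>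
    using le[OF that] by simp
  have "integrable \<Omega> (\<lambda>\<omega>. (norm (x (Suc r) \<omega> - z))\<^sup>2)"
    by (rule Bochner_Integration.integrable_bound[OF W], measurable, rule AE_I2, rule le1)
  then have "square_integrable \<Omega> (\<lambda>\<omega>. x (Suc r) \<omega> - z)" by (simp add: square_integrable_def)
  from square_integrable_add[OF this square_integrable_const[of z]]
  show "square_integrable \<Omega> (x (Suc r))" by simp
  have le2: "norm (h (x (Suc r) \<omega>)) \<le> norm (W \<omega>)" if "\<omega> \<in> space \<Omega>" for \<omega>
    using le[OF that] zero_le_power2[of "norm (x (Suc r) \<omega> - z)"] unfolding real_norm_def by linarith
  show "integrable \<Omega> (\<lambda>\<omega>. h (x (Suc r) \<omega>))"
    by (rule Bochner_Integration.integrable_bound[OF W], measurable, rule AE_I2, rule le2)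
qed

lemma iterates_square_integrable: "square_integrable \<Omega> (x r) \<and> square_integrable \<Omega> (l r)"
proof (induction r)
  case 0
  have "integrable \<Omega> (\<lambda>\<omega>. (norm (x 0 \<omega>))\<^sup>2) \<longleftrightarrow> integrable \<Omega> (\<lambda>\<omega>. (norm x0)\<^sup>2)"
    "integrable \<Omega> (\<lambda>\<omega>. (norm (l 0 \<omega>))\<^sup>2) \<longleftrightarrow> integrable \<Omega> (\<lambda>\<omega>. (norm l0)\<^sup>2)"
    by (intro Bochner_Integration.integrable_cong refl; simp add: start)+
  then show ?case by (simp add: square_integrable_def)
next
  case (Suc r)
  have x': "square_integrable \<Omega> (x (Suc r))" using Suc.IH by (intro next_primal_integrable) auto
  have "square_integrable \<Omega> (\<lambda>\<omega>. (1 - \<rho> * \<gamma>) *\<^sub>R l r \<omega> + \<rho> *\<^sub>R (A *v x (Suc r) \<omega> - b))"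
    using Suc.IH x'
    by (intro square_integrable_add square_integrable_scaleR square_integrable_diff square_integrable_mult
        square_integrable_const) auto
  moreover have "integrable \<Omega> (\<lambda>\<omega>. (norm (l (Suc r) \<omega>))\<^sup>2) \<longleftrightarrow>
    integrable \<Omega> (\<lambda>\<omega>. (norm ((1 - \<rho> * \<gamma>) *\<^sub>R l r \<omega> + \<rho> *\<^sub>R (A *v x (Suc r) \<omega> - b)))\<^sup>2)"
    by (intro Bochner_Integration.integrable_cong refl) (simp add: pda_path.dual_step[OF path])
  ultimately show ?case using x' by (simp add: square_integrable_def)
qed

lemma \<phi>_integrable: "integrable \<Omega> (\<lambda>\<omega>. \<phi> (x r \<omega>))"
proof (rule Bochner_Integration.integrable_bound)
  note \<phi>_measurable[measurable]
  have x: "square_integrable \<Omega> (x r)" using iterates_square_integrable by blast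
  show "integrable \<Omega> (\<lambda>\<omega>. \<bar>\<phi> 0\<bar> + (\<bar>g\<phi> 0 \<bullet> x r \<omega>\<bar> + \<Lambda> * (norm (x r \<omega>))\<^sup>2))"
    using x integrable_inner[OF square_integrable_const x, of "g\<phi> 0"]
    by (intro Bochner_Integration.integrable_add integrable_abs integrable_mult_right)
       (auto simp: square_integrable_def)
  show "AE \<omega> in \<Omega>. norm (\<phi> (x r \<omega>)) \<le> norm (\<bar>\<phi> 0\<bar> + (\<bar>g\<phi> 0 \<bullet> x r \<omega>\<bar> + \<Lambda> * (norm (x r \<omega>))\<^sup>2))"
  proof (rule AE_I2)
    fix \<omega>
    have "0 \<le> \<Lambda> * (norm (x r \<omega>))\<^sup>2" using \<Lambda>_nonneg by simp
    then show "norm (\<phi> (x r \<omega>)) \<le> norm (\<bar>\<phi> 0\<bar> + (\<bar>g\<phi> 0 \<bullet> x r \<omega>\<bar> + \<Lambda> * (norm (x r \<omega>))\<^sup>2))"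
      using smooth_quadratic_bound[OF grad lip, of "x r \<omega>" 0] by simp
  qed
  show "(\<lambda>\<omega>. \<phi> (x r \<omega>)) \<in> borel_measurable \<Omega>" by measurable
qed

abbreviation "pot r \<omega> \<equiv> potential_Q A B b \<phi> h \<rho> \<gamma> \<beta> \<Lambda> (x r \<omega>) (l r \<omega>) (x (Suc r) \<omega>) (l (Suc r) \<omega>)"

text \<open>The potential contains inner products of the dual iterate with the residual, which have no sign;
hence the integrability rests on the second moments of the iterates.\<close>

lemma potential_integrable: "integrable \<Omega> (pot r)"
proof -
  have x: "square_integrable \<Omega> (x s)" and l: "square_integrable \<Omega> (l s)" for s
    using iterates_square_integrable by auto
  have sq: "integrable \<Omega> (\<lambda>\<omega>. (norm (u \<omega>))\<^sup>2)" if "square_integrable \<Omega> u" for u :: "'w \<Rightarrow> real^'k"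
    using that by (simp add: square_integrable_def)
  have h: "integrable \<Omega> (\<lambda>\<omega>. h (x (Suc r) \<omega>))" by (intro next_primal_integrable x l)
  show ?thesis
    unfolding potential_Q_def potential_C_def wnorm_sq_gram
    by (intro Bochner_Integration.integrable_add integrable_mult_right \<phi>_integrable h integrable_inner sq
        square_integrable_diff square_integrable_scaleR square_integrable_mult square_integrable_const x l)
qed

abbreviation "merit gradf r \<omega> \<equiv>
  optimality_gap A X gradf h \<rho> \<beta> (x r \<omega>) (l r \<omega>) (x (Suc r) \<omega>) (l (Suc r) \<omega>)
    + (norm (A *v x (Suc r) \<omega> - b))\<^sup>2"

text \<open>Each summand of the merit function is nonnegative and measurable, so its integrability follows from
the integrable upper bound that \<open>pathwise_bound\<close> gives for the sum.\<close>

theorem expected_merit_bound: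
  assumes R: "1 \<le> R" "real R \<le> \<nu>" and \<epsilon>: "0 < \<epsilon>"
    and slack: "(1 + \<epsilon>) * (\<gamma> * real R * (1 - \<rho> * \<gamma>)) \<le> 1 - \<epsilon>"
    and gradf: "continuous_on UNIV gradf" and bias: "\<And>y. norm (g\<phi> y - gradf y) \<le> t"
    and low: "\<And>\<omega>. \<omega> \<in> space \<Omega> \<Longrightarrow> - \<tau> \<le> \<phi> (x 1 \<omega>)"
    and second: "\<And>r. (\<integral>\<omega>. (norm (G r \<omega> - g\<phi> (x r \<omega>)))\<^sup>2 \<partial>\<Omega>) \<le> s2 / real R"
  shows "r \<in> {1..R} \<Longrightarrow> integrable \<Omega> (merit gradf r)"
    and "(\<Sum>r=1..R. \<integral>\<omega>. merit gradf r \<omega> \<partial>\<Omega>)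
      \<le> step_factor \<epsilon> \<nu> / descent_rate * (\<integral>\<omega>. pot 0 \<omega> - pot R \<omega> \<partial>\<Omega>)
        + 2 * (\<integral>\<omega>. pot 0 \<omega> \<partial>\<Omega>) / (1 - \<rho> * \<gamma>)
        + (gap_factor + 7 / 2 * (step_factor \<epsilon> \<nu> / descent_rate)) * (2 * s2)
        + gap_factor * \<nu> * t\<^sup>2 + 2 * \<tau> / (1 - \<rho> * \<gamma>)"
proof -
  define c where "c = step_factor \<epsilon> \<nu> / descent_rate"
  define k where "k = gap_factor + 7 / 2 * c"
  define w where "w = gap_factor * \<nu> * t\<^sup>2 + 2 * \<tau> / (1 - \<rho> * \<gamma>)"
  define err2 where "err2 r \<omega> = (norm (G r \<omega> - g\<phi> (x r \<omega>)))\<^sup>2" for r \<omega>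
  define U where "U \<omega> = c * (pot 0 \<omega> - pot R \<omega>) + 2 * pot 0 \<omega> / (1 - \<rho> * \<gamma>) + k * (\<Sum>r\<le>R. err2 r \<omega>) + w" for \<omega>
  have err2: "integrable \<Omega> (err2 r)" for r
    using err_square_integrable[of r] unfolding square_integrable_def err2_def by auto
  have U: "integrable \<Omega> U"
    unfolding U_def
    by (intro Bochner_Integration.integrable_add integrable_mult_right integrable_divide Bochner_Integration.integrable_diff
        Bochner_Integration.integrable_sum potential_integrable err2) simp
  have pw: "(\<Sum>r=1..R. merit gradf r \<omega>) \<le> U \<omega>" if \<omega>: "\<omega> \<in> space \<Omega>" for \<omega>
    using pda_path.pathwise_bound[OF path[OF \<omega>] R \<epsilon> slack bias low[OF \<omega>]]
    unfolding pda_path.Q_def[OF path[OF \<omega>]] pda_path.errs_def[OF path[OF \<omega>]] pda_path.err_def[OF path[OF \<omega>]]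
      U_def k_def c_def w_def err2_def by simp
  have nn: "0 \<le> merit gradf r \<omega>" for r \<omega> by (intro add_nonneg_nonneg gap_nonneg) simp
  have meas: "(\<lambda>\<omega>. merit gradf r \<omega>) \<in> borel_measurable \<Omega>" for r
  proof -
    have [measurable]: "(*v) A \<in> borel_measurable borel"
      by (intro borel_measurable_continuous_onI linear_continuous_on matrix_vector_mul_bounded_linear)
    note gap_measurable[OF X_nonempty gradf x_measurable l_measurable x_measurable l_measurable, measurable]
    show ?thesis by measurable
  qed
  show int: "integrable \<Omega> (merit gradf r)" if r: "r \<in> {1..R}" for r
  proof (rule Bochner_Integration.integrable_bound[OF U meas])
    have le: "norm (merit gradf r \<omega>) \<le> norm (U \<omega>)" if \<omega>: "\<omega> \<in> space \<Omega>" for \<omega>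
    proof -
      have "merit gradf r \<omega> \<le> (\<Sum>r=1..R. merit gradf r \<omega>)"
        using r nn by (intro member_le_sum[where f="\<lambda>r. merit gradf r \<omega>"]) auto
      then show ?thesis using pw[OF \<omega>] nn[of r \<omega>] by simp
    qed
    show "AE \<omega> in \<Omega>. norm (merit gradf r \<omega>) \<le> norm (U \<omega>)" by (rule AE_I2) (rule le)
  qed
  have s2: "0 \<le> s2"
  proof -
    have "0 \<le> (\<integral>\<omega>. err2 0 \<omega> \<partial>\<Omega>)" by (rule Bochner_Integration.integral_nonneg) (simp add: err2_def)
    also have "\<dots> \<le> s2 / real R" unfolding err2_def by (rule second)
    finally show ?thesis using R by (simp add: zero_le_divide_iff)
  qed
  have "0 \<le> step_factor \<epsilon> \<nu>" using step_factor_pos[OF \<epsilon>, of \<nu>] R by simp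
  then have k0: "0 \<le> k" using gap_factor_pos descent_rate_pos by (simp add: k_def c_def)
  have "(\<Sum>r\<le>R. \<integral>\<omega>. err2 r \<omega> \<partial>\<Omega>) \<le> (\<Sum>r\<le>R. s2 / real R)"
    unfolding err2_def by (intro sum_mono second)
  also have "\<dots> = (real R + 1) * s2 / real R" by simp
  also have "\<dots> \<le> (2 * real R) * s2 / real R"
    using R s2 by (intro divide_right_mono mult_right_mono) auto
  also have "\<dots> = 2 * s2" using R by simp
  finally have errs: "(\<Sum>r\<le>R. \<integral>\<omega>. err2 r \<omega> \<partial>\<Omega>) \<le> 2 * s2" .
  have "(\<Sum>r=1..R. \<integral>\<omega>. merit gradf r \<omega> \<partial>\<Omega>) = (\<integral>\<omega>. (\<Sum>r=1..R. merit gradf r \<omega>) \<partial>\<Omega>)"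
    by (rule Bochner_Integration.integral_sum[symmetric]) (rule int)
  also have "\<dots> \<le> (\<integral>\<omega>. U \<omega> \<partial>\<Omega>)"
    by (intro integral_mono U Bochner_Integration.integrable_sum int pw)
  also have "\<dots> = c * (\<integral>\<omega>. pot 0 \<omega> - pot R \<omega> \<partial>\<Omega>) + 2 * (\<integral>\<omega>. pot 0 \<omega> \<partial>\<Omega>) / (1 - \<rho> * \<gamma>)
      + k * (\<Sum>r\<le>R. \<integral>\<omega>. err2 r \<omega> \<partial>\<Omega>) + w"
  proof -
    note p = potential_integrable[of 0] potential_integrable[of R]
    have e: "integrable \<Omega> (\<lambda>\<omega>. \<Sum>r\<le>R. err2 r \<omega>)" by (intro Bochner_Integration.integrable_sum err2)
    have s: "(\<integral>\<omega>. (\<Sum>r\<le>R. err2 r \<omega>) \<partial>\<Omega>) = (\<Sum>r\<le>R. \<integral>\<omega>. err2 r \<omega> \<partial>\<Omega>)"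
      by (intro Bochner_Integration.integral_sum err2)
    show ?thesis
      unfolding U_def s[symmetric] using p e
      by (simp add: prob_space)
  qed
  also have "\<dots> \<le> c * (\<integral>\<omega>. pot 0 \<omega> - pot R \<omega> \<partial>\<Omega>) + 2 * (\<integral>\<omega>. pot 0 \<omega> \<partial>\<Omega>) / (1 - \<rho> * \<gamma>)
      + k * (2 * s2) + w"
    using mult_left_mono[OF errs k0] by simp
  finally show "(\<Sum>r=1..R. \<integral>\<omega>. merit gradf r \<omega> \<partial>\<Omega>)
      \<le> step_factor \<epsilon> \<nu> / descent_rate * (\<integral>\<omega>. pot 0 \<omega> - pot R \<omega> \<partial>\<Omega>)
        + 2 * (\<integral>\<omega>. pot 0 \<omega> \<partial>\<Omega>) / (1 - \<rho> * \<gamma>)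
        + (gap_factor + 7 / 2 * (step_factor \<epsilon> \<nu> / descent_rate)) * (2 * s2)
        + gap_factor * \<nu> * t\<^sup>2 + 2 * \<tau> / (1 - \<rho> * \<gamma>)"
    unfolding c_def k_def w_def by simp
qed

end


section \<open>Proof of the convergence rate\<close>

lemma estimator_error_second_moment:
  fixes v :: "nat \<Rightarrow> nat \<Rightarrow> 'w \<Rightarrow> real^'n"
  assumes samp: "sampling \<Omega> D J v \<xi>"
    and est: "estimator_bounds \<Omega> (past \<Omega> D J v \<xi>) G g\<phi> x s2 J"
    and G: "G r \<in> borel_measurable \<Omega>" and x: "x r \<in> borel_measurable \<Omega>"
    and g\<phi>: "continuous_on UNIV g\<phi>" and s2: "0 \<le> s2"
  shows "square_integrable \<Omega> (\<lambda>\<omega>. G r \<omega> - g\<phi> (x r \<omega>))"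
    and "(\<integral>\<omega>. (norm (G r \<omega> - g\<phi> (x r \<omega>)))\<^sup>2 \<partial>\<Omega>) \<le> s2 / real J"
proof -
  interpret prob_space \<Omega> using samp by (simp add: sampling_def)
  note G[measurable] x[measurable]
  have [measurable]: "g\<phi> \<in> borel_measurable borel" by (intro borel_measurable_continuous_onI g\<phi>)
  have e[measurable]: "(\<lambda>\<omega>. G r \<omega> - g\<phi> (x r \<omega>)) \<in> borel_measurable \<Omega>" by measurable
  have nn: "(\<integral>\<^sup>+\<omega>. ennreal ((norm (G r \<omega> - g\<phi> (x r \<omega>)))\<^sup>2) \<partial>\<Omega>) \<le> ennreal (s2 / real J)"
    using est unfolding estimator_bounds_def
    by (intro nn_integral_le_of_cond_exp_le[OF prob_space_axioms past_subalgebra[OF samp, of r]]) auto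
  have int: "integrable \<Omega> (\<lambda>\<omega>. (norm (G r \<omega> - g\<phi> (x r \<omega>)))\<^sup>2)"
    by (intro integrableI_nonneg) (auto intro: le_less_trans[OF nn])
  then show "square_integrable \<Omega> (\<lambda>\<omega>. G r \<omega> - g\<phi> (x r \<omega>))"
    using e by (simp add: square_integrable_def)
  have "ennreal (\<integral>\<omega>. (norm (G r \<omega> - g\<phi> (x r \<omega>)))\<^sup>2 \<partial>\<Omega>) \<le> ennreal (s2 / real J)"
    using nn by (subst (asm) nn_integral_eq_integral[OF int]) auto
  then show "(\<integral>\<omega>. (norm (G r \<omega> - g\<phi> (x r \<omega>)))\<^sup>2 \<partial>\<Omega>) \<le> s2 / real J"
    using s2 by (subst (asm) ennreal_le_iff) auto
qed

lemma zo_gradient_avg_measurable: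
  fixes v :: "nat \<Rightarrow> nat \<Rightarrow> 'w \<Rightarrow> real^'n"
  assumes samp: "sampling \<Omega> D J v \<xi>" and x[measurable]: "x \<in> borel_measurable \<Omega>"
    and F: "(\<lambda>(x, \<xi>). F x \<xi>) \<in> borel_measurable (borel \<Otimes>\<^sub>M D)"
  shows "(\<lambda>\<omega>. zo_gradient_avg \<mu> F J (x \<omega>) (\<lambda>j. v r j \<omega>) (\<lambda>j. \<xi> r j \<omega>)) \<in> borel_measurable \<Omega>"
proof -
  have "(\<lambda>\<omega>. zo_gradient \<mu> F (x \<omega>) (v r j \<omega>) (\<xi> r j \<omega>)) \<in> borel_measurable \<Omega>" if j: "j \<in> {1..J}" for j
  proof -
    note pair = sampling_measurable[OF samp j, of r]
    have v[measurable]: "v r j \<in> borel_measurable \<Omega>" using measurable_fst'[OF pair] by simp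
    have \<xi>[measurable]: "\<xi> r j \<in> measurable \<Omega> D" using measurable_snd'[OF pair] by simp
    have [measurable]: "(\<lambda>\<omega>. F (u \<omega>) (\<xi> r j \<omega>)) \<in> borel_measurable \<Omega>"
      if [measurable]: "u \<in> borel_measurable \<Omega>" for u
      using measurable_compose[OF measurable_Pair[OF that \<xi>] F] by simp
    show ?thesis unfolding zo_gradient_def by measurable
  qed
  then show ?thesis unfolding zo_gradient_avg_def
    by (intro borel_measurable_scaleR borel_measurable_sum) auto
qed

theorem mainTheorem2:
  fixes A B :: "real^'n^'m" and \<rho> \<gamma> \<beta> L\<mu> :: real
  assumes "psd (transpose A ** A + transpose B ** B - mat 1)"
    and "0 < \<rho>" "0 < \<gamma>" "0 < \<beta>"
    and "\<rho> * \<gamma> < 1"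
    and "\<rho> \<ge> \<beta>"
    and "(1 - \<rho> * \<gamma>) * \<gamma> / 2 + \<gamma> - (1 - \<rho> * \<gamma>) / \<rho> > 0"
    and "\<beta> > (3 + 3 * L\<mu>) * L\<mu> + 2"
  shows "\<exists>V ct :: real. 0 < V \<and> 0 < ct \<and>
    (\<forall>(R::nat) (J::nat) (\<mu>::real) (\<kappa>::real) (b::real^'m) (X::(real^'n) set)
      (f::real^'n \<Rightarrow> real) (gradf::real^'n \<Rightarrow> real^'n) (gradf\<mu>::real^'n \<Rightarrow> real^'n) (L::real)
      (h::real^'n \<Rightarrow> real) (D::'e measure) (F::real^'n \<Rightarrow> 'e \<Rightarrow> real)
      (gradF::real^'n \<Rightarrow> 'e \<Rightarrow> real^'n) (\<sigma>::real) (K::real)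
      (\<Omega>::'w measure) (v::nat \<Rightarrow> nat \<Rightarrow> 'w \<Rightarrow> real^'n) (\<xi>::nat \<Rightarrow> nat \<Rightarrow> 'w \<Rightarrow> 'e)
      (x0::real^'n) (l0::real^'m) (x::nat \<Rightarrow> 'w \<Rightarrow> real^'n) (l::nat \<Rightarrow> 'w \<Rightarrow> real^'m)
      (G::nat \<Rightarrow> 'w \<Rightarrow> real^'n) (a::'w \<Rightarrow> nat) (\<Psi>::nat \<Rightarrow> 'w \<Rightarrow> real) (Q::nat \<Rightarrow> 'w \<Rightarrow> real)
      (s2::real) (\<alpha>0::real).
      1 \<le> R \<longrightarrow>
      J = R \<longrightarrow>
      0 < \<mu> \<longrightarrow> \<mu> \<le> 1 / sqrt (real R) \<longrightarrow>
      \<alpha>0 = \<rho> * \<gamma> \<longrightarrow>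
      \<gamma> \<le> \<kappa> / real R \<longrightarrow> \<kappa> * (1 - \<alpha>0) < 1 \<longrightarrow>
      composite_problem X f gradf L h \<longrightarrow>
      stochastic_oracle D F gradF f gradf \<sigma> K \<longrightarrow>
      (\<forall>y. GDERIV (smoothing \<mu> f) y :> gradf\<mu> y) \<longrightarrow>
      L\<mu>-lipschitz_on UNIV gradf\<mu> \<longrightarrow> L\<mu> \<le> L \<longrightarrow> (0 < L\<mu> \<or> L = 0) \<longrightarrow>
      (\<forall>y. norm (gradf\<mu> y - gradf y) \<le> \<mu> * real CARD('n) * L / 2) \<longrightarrow>
      sampling \<Omega> D J v \<xi> \<longrightarrow>
      G = (\<lambda>r \<omega>. zo_gradient_avg \<mu> F J (x r \<omega>) (\<lambda>j. v r j \<omega>) (\<lambda>j. \<xi> r j \<omega>)) \<longrightarrow>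
      pzo_pda \<Omega> A B b X h \<rho> \<gamma> \<beta> G x0 l0 x l \<longrightarrow>
      s2 = sigma_tilde_sq CARD('n) K \<sigma> \<mu> L \<longrightarrow>
      estimator_bounds \<Omega> (past \<Omega> D J v \<xi>) G gradf\<mu> x s2 J \<longrightarrow>
      distr \<Omega> (count_space UNIV) a = measure_pmf (pmf_of_set {1..R}) \<longrightarrow>
      independent_rvs \<Omega> (count_space UNIV) a
        (PiM UNIV (\<lambda>_. borel)) (\<lambda>\<omega> r. (x r \<omega>, l r \<omega>)) \<longrightarrow>
      \<Psi> = (\<lambda>r \<omega>. optimality_gap A X gradf h \<rho> \<beta> (x r \<omega>) (l r \<omega>) (x (Suc r) \<omega>) (l (Suc r) \<omega>)) \<longrightarrow>
      Q = (\<lambda>r \<omega>. potential_Q A B b (smoothing \<mu> f) h \<rho> \<gamma> \<beta> L\<mu>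
                   (x r \<omega>) (l r \<omega>) (x (Suc r) \<omega>) (l (Suc r) \<omega>)) \<longrightarrow>
      (\<integral>\<omega>. \<Psi> (a \<omega>) \<omega> + (norm (A *v x (Suc (a \<omega>)) \<omega> - b))\<^sup>2 \<partial>\<Omega>)
        \<le> 4 * V / real R * (\<integral>\<omega>. Q 0 \<omega> - Q R \<omega> \<partial>\<Omega>)
          + 2 * (\<integral>\<omega>. Q 0 \<omega> \<partial>\<Omega>) / (real R * (1 - \<alpha>0))
          + ct * s2 / real R
          + L\<^sup>2 * (real CARD('n))\<^sup>2 / real R)"
proof -
  interpret pda_params A B \<rho> \<gamma> \<beta> L\<mu>
    by unfold_locales (use assms psd_gram_lower_bound in auto)
  define \<delta> where "\<delta> = 1 - \<rho> * \<gamma>"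
  have \<delta>: "0 < \<delta>" using damping by (simp add: \<delta>_def)
  obtain \<epsilon> where \<epsilon>: "0 < \<epsilon>" and slack: "\<And>R::nat. real R * (\<gamma> * \<delta>) < 1 \<Longrightarrow> (1 + \<epsilon>) * (real R * (\<gamma> * \<delta>)) \<le> 1 - \<epsilon>"
    using discrete_slack[of "\<gamma> * \<delta>"] pos \<delta> by auto
  \<comment> \<open>An upper bound for every admissible number of iterations.\<close>
  define \<nu> where "\<nu> = 1 / (\<gamma> * \<delta>)"
  have \<nu>: "0 < \<nu>" using pos \<delta> by (simp add: \<nu>_def)
  define c where "c = step_factor \<epsilon> \<nu> / descent_rate"
  have c: "0 < c" using step_factor_pos[OF \<epsilon>, of \<nu>] \<nu> descent_rate_pos by (simp add: c_def)
  define ct where "ct = 2 * (gap_factor + 7 / 2 * c) + gap_factor * \<nu> / 8 + 1 / (\<bar>L\<mu>\<bar> * \<delta>)"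
  have ct: "0 < ct"
    unfolding ct_def using gap_factor_pos c \<nu> \<delta> by (intro add_pos_nonneg) auto
  show ?thesis
  proof (rule exI[of _ "c / 4"], rule exI[of _ ct], intro conjI allI impI)
    show "0 < c / 4" "0 < ct" using c ct by auto
  next
    fix R J :: nat and \<mu> \<kappa> :: real and b :: "real^'m" and X :: "(real^'n) set"
      and f :: "real^'n \<Rightarrow> real" and gradf gradf\<mu> :: "real^'n \<Rightarrow> real^'n" and L :: real
      and h :: "real^'n \<Rightarrow> real" and D :: "'e measure" and F :: "real^'n \<Rightarrow> 'e \<Rightarrow> real"
      and gradF :: "real^'n \<Rightarrow> 'e \<Rightarrow> real^'n" and \<sigma> K :: real
      and \<Omega> :: "'w measure" and v :: "nat \<Rightarrow> nat \<Rightarrow> 'w \<Rightarrow> real^'n" and \<xi> :: "nat \<Rightarrow> nat \<Rightarrow> 'w \<Rightarrow> 'e"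
      and x0 :: "real^'n" and l0 :: "real^'m" and x :: "nat \<Rightarrow> 'w \<Rightarrow> real^'n" and l :: "nat \<Rightarrow> 'w \<Rightarrow> real^'m"
      and G :: "nat \<Rightarrow> 'w \<Rightarrow> real^'n" and a :: "'w \<Rightarrow> nat" and \<Psi> Q :: "nat \<Rightarrow> 'w \<Rightarrow> real"
      and s2 \<alpha>0 :: real
    assume R: "1 \<le> R" and J: "J = R" and \<mu>: "0 < \<mu>" "\<mu> \<le> 1 / sqrt (real R)" and \<alpha>0: "\<alpha>0 = \<rho> * \<gamma>"
      and \<kappa>: "\<gamma> \<le> \<kappa> / real R" "\<kappa> * (1 - \<alpha>0) < 1"
      and prob: "composite_problem X f gradf L h"
      and noise: "stochastic_oracle D F gradF f gradf \<sigma> K"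
      and grad\<mu>: "\<forall>y. GDERIV (smoothing \<mu> f) y :> gradf\<mu> y" and lip\<mu>: "L\<mu>-lipschitz_on UNIV gradf\<mu>"
      and L\<mu>: "L\<mu> \<le> L" "0 < L\<mu> \<or> L = 0"
      and bias: "\<forall>y. norm (gradf\<mu> y - gradf y) \<le> \<mu> * real CARD('n) * L / 2"
      and samp: "sampling \<Omega> D J v \<xi>"
      and G: "G = (\<lambda>r \<omega>. zo_gradient_avg \<mu> F J (x r \<omega>) (\<lambda>j. v r j \<omega>) (\<lambda>j. \<xi> r j \<omega>))"
      and alg: "pzo_pda \<Omega> A B b X h \<rho> \<gamma> \<beta> G x0 l0 x l"
      and s2: "s2 = sigma_tilde_sq CARD('n) K \<sigma> \<mu> L"
      and est: "estimator_bounds \<Omega> (past \<Omega> D J v \<xi>) G gradf\<mu> x s2 J"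
      and law: "distr \<Omega> (count_space UNIV) a = measure_pmf (pmf_of_set {1..R})"
      and indep: "independent_rvs \<Omega> (count_space UNIV) a (PiM UNIV (\<lambda>_. borel)) (\<lambda>\<omega> r. (x r \<omega>, l r \<omega>))"
      and \<Psi>: "\<Psi> = (\<lambda>r \<omega>. optimality_gap A X gradf h \<rho> \<beta> (x r \<omega>) (l r \<omega>) (x (Suc r) \<omega>) (l (Suc r) \<omega>))"
      and Q: "Q = (\<lambda>r \<omega>. potential_Q A B b (smoothing \<mu> f) h \<rho> \<gamma> \<beta> L\<mu>
                   (x r \<omega>) (l r \<omega>) (x (Suc r) \<omega>) (l (Suc r) \<omega>))"
    have fg: "\<And>y. GDERIV f y :> gradf y" and lipf: "L-lipschitz_on UNIV gradf"
      and f0: "\<And>y. y \<in> X \<Longrightarrow> 0 \<le> f y"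
      using prob by (auto simp: composite_problem_def)
    have Rpos: "0 < real R" using R by simp
    have \<Omega>: "prob_space \<Omega>" using samp by (simp add: sampling_def)
    interpret pda_problem A B \<rho> \<gamma> \<beta> L\<mu> b X h "smoothing \<mu> f" gradf\<mu>
      by unfold_locales (use prob grad\<mu> lip\<mu> in \<open>auto simp: composite_problem_def\<close>)
    have L\<mu>0: "0 \<le> L\<mu>" by (rule \<Lambda>_nonneg)
    then have L0: "0 \<le> L" using L\<mu> by simp
    have F: "(\<lambda>(x, \<xi>). F x \<xi>) \<in> borel_measurable (borel \<Otimes>\<^sub>M D)"
      using noise by (simp add: stochastic_oracle_def)
    define N where "N = real CARD('n)"
    have N: "1 \<le> N" by (simp add: N_def Suc_le_eq)

    \<comment> \<open>The variance proxy \<open>s2\<close> dominates the gradient bias \<open>t\<close> and the lower bias \<open>\<tau>\<close> of the smoothing.\<close>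
    have s2_ge: "2 * (\<mu>\<^sup>2 * L\<^sup>2 * N\<^sup>2) \<le> s2"
    proof -
      have "0 \<le> 2 * N * (K\<^sup>2 + \<sigma>\<^sup>2)" using N by simp
      then show ?thesis
        by (simp add: s2 sigma_tilde_sq_def N_def[symmetric] power2_eq_square algebra_simps)
    qed
    have "0 \<le> \<mu>\<^sup>2 * L\<^sup>2 * N\<^sup>2" by simp
    then have s20: "0 \<le> s2" using s2_ge by linarith
    define t where "t = \<mu> * N * L / 2"
    have t: "t\<^sup>2 \<le> s2 / 8"
      using s2_ge by (simp add: t_def power_mult_distrib power_divide field_simps)
    define \<tau> where "\<tau> = L * \<mu>\<^sup>2"
    \<comment> \<open>The bias \<open>\<tau>\<close> is linear in \<open>L\<close> and the proxy quadratic; \<open>L\<mu> \<le> L\<close> makes up for the missing factor.\<close>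
    have \<tau>: "2 * \<tau> / \<delta> \<le> 1 / (\<bar>L\<mu>\<bar> * \<delta>) * s2"
    proof (cases "L = 0")
      case True
      then show ?thesis using s20 \<delta> by (simp add: \<tau>_def)
    next
      case False
      then have p: "0 < L\<mu>" using L\<mu> by auto
      have "2 * \<tau> * L\<mu> \<le> 2 * \<tau> * L"
        using L\<mu>(1) L0 by (intro mult_left_mono) (auto simp: \<tau>_def)
      also have "\<dots> = 2 * (\<mu>\<^sup>2 * L\<^sup>2 * 1)" by (simp add: \<tau>_def power2_eq_square)
      also have "\<dots> \<le> 2 * (\<mu>\<^sup>2 * L\<^sup>2 * N\<^sup>2)"
        using N by (intro mult_left_mono) auto
      finally have "2 * \<tau> * L\<mu> \<le> s2" using s2_ge by linarith
      then have "2 * \<tau> \<le> s2 / L\<mu>" using p by (simp add: pos_le_divide_eq)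
      then have "2 * \<tau> / \<delta> \<le> s2 / L\<mu> / \<delta>" using \<delta> by (intro divide_right_mono) auto
      then show ?thesis using p by simp
    qed

    have Z: "(\<lambda>\<omega> r. (x r \<omega>, l r \<omega>)) \<in> measurable \<Omega> (PiM UNIV (\<lambda>_. borel))"
      using indep by (simp add: independent_rvs_def)
    have comp: "(\<lambda>z. z r) \<in> measurable (PiM UNIV (\<lambda>_. borel)) (borel :: ((real^'n) \<times> (real^'m)) measure)" for r :: nat
      by (rule measurable_component_singleton) simp
    have fstm: "fst \<in> borel_measurable (borel :: ((real^'n) \<times> (real^'m)) measure)"
      and sndm: "snd \<in> borel_measurable (borel :: ((real^'n) \<times> (real^'m)) measure)"
      by (intro borel_measurable_continuous_onI continuous_intros)+
    have x[measurable]: "x r \<in> borel_measurable \<Omega>" and l[measurable]: "l r \<in> borel_measurable \<Omega>" for r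
      using measurable_compose[OF measurable_compose[OF Z comp[of r]] fstm]
        measurable_compose[OF measurable_compose[OF Z comp[of r]] sndm] by simp_all
    have g\<mu>c: "continuous_on UNIV gradf\<mu>" and gfc: "continuous_on UNIV gradf"
      using lip\<mu> lipf by (auto intro: lipschitz_on_continuous_on)
    have Gm: "G r \<in> borel_measurable \<Omega>" for r
      unfolding G by (rule zo_gradient_avg_measurable[OF samp x F])
    note err = estimator_error_second_moment[OF samp est Gm x g\<mu>c s20]

    interpret random_pda A B \<rho> \<gamma> \<beta> L\<mu> b X h "smoothing \<mu> f" gradf\<mu> \<Omega> G x l x0 l0
    proof (intro random_pda.intro random_pda_axioms.intro)
      show "pda_problem A B \<rho> \<gamma> \<beta> L\<mu> X h (smoothing \<mu> f) gradf\<mu>" by (rule pda_problem_axioms)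
      fix \<omega> assume "\<omega> \<in> space \<Omega>"
      note run = bspec[OF alg[unfolded pzo_pda_def] this]
      show "x 0 \<omega> = x0" "l 0 \<omega> = l0" using run by blast+
      show "pda_path A B \<rho> \<gamma> \<beta> L\<mu> b X h (smoothing \<mu> f) gradf\<mu> (\<lambda>r. G r \<omega>) (\<lambda>r. x r \<omega>) (\<lambda>r. l r \<omega>)"
        by (rule pda_path.intro[OF pda_problem_axioms], rule pda_path_axioms.intro) (use run in blast)+
    qed (rule \<Omega> x l err(1))+

    have "\<gamma> * real R \<le> \<kappa>" using \<kappa>(1) Rpos by (simp add: field_simps)
    then have "\<gamma> * real R * \<delta> \<le> \<kappa> * \<delta>" using \<delta> by (intro mult_right_mono) auto
    then have R\<delta>: "real R * (\<gamma> * \<delta>) < 1" using \<kappa>(2) by (simp add: \<alpha>0 \<delta>_def mult_ac)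
    have R\<nu>: "real R \<le> \<nu>"
      using R\<delta> pos \<delta> by (simp add: \<nu>_def pos_le_divide_eq)
    have sl: "(1 + \<epsilon>) * (\<gamma> * real R * (1 - \<rho> * \<gamma>)) \<le> 1 - \<epsilon>"
      using slack[OF R\<delta>] by (simp add: \<delta>_def mult_ac)
    have bias': "norm (gradf\<mu> y - gradf y) \<le> t" for y
      using bias by (simp add: t_def N_def)
    have low: "- \<tau> \<le> smoothing \<mu> f (x 1 \<omega>)" if "\<omega> \<in> space \<Omega>" for \<omega>
      using smoothing_lower_bound[OF fg lipf, of "x 1 \<omega>" \<mu>] f0[OF x_in[OF that, of 0]]
      by (simp add: \<tau>_def)
    note bound = expected_merit_bound[OF R R\<nu> \<epsilon> sl gfc bias' low err(2)[unfolded J]]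

    \<comment> \<open>The merit function in terms of the trajectory of iterates, from which \<open>a\<close> is independent.\<close>
    define \<Phi> where "\<Phi> r z = optimality_gap A X gradf h \<rho> \<beta> (fst (z r)) (snd (z r)) (fst (z (Suc r))) (snd (z (Suc r)))
        + (norm (A *v fst (z (Suc r)) - b))\<^sup>2" for r and z :: "nat \<Rightarrow> (real^'n) \<times> (real^'m)"
    have \<Phi>m: "\<Phi> r \<in> borel_measurable (PiM UNIV (\<lambda>_. borel))" for r
    proof -
      note c = measurable_compose[OF comp fstm] measurable_compose[OF comp sndm]
      note c[measurable] gap_measurable[OF X_nonempty gfc c(1) c(2) c(1) c(2), measurable]
      have [measurable]: "(*v) A \<in> borel_measurable borel"
        by (intro borel_measurable_continuous_onI linear_continuous_on matrix_vector_mul_bounded_linear)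
      show ?thesis unfolding \<Phi>_def by measurable
    qed
    have \<Phi>x: "\<Phi> r (\<lambda>r. (x r \<omega>, l r \<omega>)) = merit gradf r \<omega>" for r \<omega>
      by (simp add: \<Phi>_def)
    have \<Phi>int: "integrable \<Omega> (\<lambda>\<omega>. \<Phi> r (\<lambda>r. (x r \<omega>, l r \<omega>)))" if "r \<in> {1..R}" for r
      unfolding \<Phi>x by (rule bound(1)[OF _ that])
    have "(\<integral>\<omega>. \<Psi> (a \<omega>) \<omega> + (norm (A *v x (Suc (a \<omega>)) \<omega> - b))\<^sup>2 \<partial>\<Omega>)
        = (\<integral>\<omega>. \<Phi> (a \<omega>) (\<lambda>r. (x r \<omega>, l r \<omega>)) \<partial>\<Omega>)"
      by (simp add: \<Phi>_def \<Psi>)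
    also have "\<dots> = (\<Sum>r=1..R. \<integral>\<omega>. merit gradf r \<omega> \<partial>\<Omega>) / real R"
      using expectation_at_uniform_index[where \<Phi>=\<Phi>, OF \<Omega> law R indep \<Phi>m \<Phi>int] unfolding \<Phi>x .
    also have "\<dots> \<le> (c * (\<integral>\<omega>. Q 0 \<omega> - Q R \<omega> \<partial>\<Omega>) + 2 * (\<integral>\<omega>. Q 0 \<omega> \<partial>\<Omega>) / \<delta>
        + (gap_factor + 7 / 2 * c) * (2 * s2) + gap_factor * \<nu> * t\<^sup>2 + 2 * \<tau> / \<delta>) / real R"
      unfolding c_def \<delta>_def Q using bound(2) by (intro divide_right_mono) simp_all
    also have "\<dots> \<le> (c * (\<integral>\<omega>. Q 0 \<omega> - Q R \<omega> \<partial>\<Omega>) + 2 * (\<integral>\<omega>. Q 0 \<omega> \<partial>\<Omega>) / \<delta> + ct * s2) / real R"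
    proof (intro divide_right_mono)
      have "gap_factor * \<nu> * t\<^sup>2 \<le> gap_factor * \<nu> * (s2 / 8)"
        using t gap_factor_pos \<nu> by (intro mult_left_mono) auto
      then show "c * (\<integral>\<omega>. Q 0 \<omega> - Q R \<omega> \<partial>\<Omega>) + 2 * (\<integral>\<omega>. Q 0 \<omega> \<partial>\<Omega>) / \<delta>
        + (gap_factor + 7 / 2 * c) * (2 * s2) + gap_factor * \<nu> * t\<^sup>2 + 2 * \<tau> / \<delta>
        \<le> c * (\<integral>\<omega>. Q 0 \<omega> - Q R \<omega> \<partial>\<Omega>) + 2 * (\<integral>\<omega>. Q 0 \<omega> \<partial>\<Omega>) / \<delta> + ct * s2"
        using \<tau> unfolding ct_def by (simp add: algebra_simps)
    qed simp
    also have "\<dots> = 4 * (c / 4) / real R * (\<integral>\<omega>. Q 0 \<omega> - Q R \<omega> \<partial>\<Omega>)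
          + 2 * (\<integral>\<omega>. Q 0 \<omega> \<partial>\<Omega>) / (real R * (1 - \<alpha>0)) + ct * s2 / real R"
      by (simp add: add_divide_distrib \<alpha>0 \<delta>_def mult.commute)
    also have "\<dots> \<le> 4 * (c / 4) / real R * (\<integral>\<omega>. Q 0 \<omega> - Q R \<omega> \<partial>\<Omega>)
          + 2 * (\<integral>\<omega>. Q 0 \<omega> \<partial>\<Omega>) / (real R * (1 - \<alpha>0)) + ct * s2 / real R
          + L\<^sup>2 * (real CARD('n))\<^sup>2 / real R"
      by simp
    finally show "(\<integral>\<omega>. \<Psi> (a \<omega>) \<omega> + (norm (A *v x (Suc (a \<omega>)) \<omega> - b))\<^sup>2 \<partial>\<Omega>)
        \<le> 4 * (c / 4) / real R * (\<integral>\<omega>. Q 0 \<omega> - Q R \<omega> \<partial>\<Omega>)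
          + 2 * (\<integral>\<omega>. Q 0 \<omega> \<partial>\<Omega>) / (real R * (1 - \<alpha>0))
          + ct * s2 / real R
          + L\<^sup>2 * (real CARD('n))\<^sup>2 / real R" .
  qed
qed


end
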